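(* Let $n,N\ge 1$, let $n_1,\dots,n_N\ge 1$ be integers, let $f_1,\dots,f_N\in C([0,1])$, and let $$A(\varphi)=\prod_{i=1}^N :\varphi^{n_i}(f_i):$$ be the product of Wick powers of the Bernoulli noise variables $\varphi(f_i)$. Let $\psi:F\to\{1,\dots,K\}$ be any bijective numbering of the vertex set $F=\{f_i^j:\ 1\le i\le N,\ 1\le j\le n_i\}$, where $K=\sum_{i=1}^N n_i$. Then $$\mathbb{E}\,A(\varphi)=\sum_{G} I(G),$$ where the sum is over all diagrams $G$ (as defined in the context), and for a diagram $G$ given by a partition $S$ with ordered blocks $$I(G)=\prod_{s\in S}\left[(-1)^{m(s)-1}\sum_{k=1}^n\ \prod_{v\in F:\ \psi(v)\in s} f_{i(v)}\left(\frac{k}{n}\right)\frac{1}{\sqrt n}\right],$$ where $i(v)=i$ for $v=f_i^j$, the factor $\frac1{\sqrt n}$ is inside the product over $v$ (one factor per vertex), and $m(s)$ is the number of pairs $(a_r,a_{r+1})$ of neighbouring elements in the ordered block $s=(a_1,\dots,a_{|s|})$ with $a_r\le a_{r+1}$.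
   Context: Bernoulli noise: $(\varepsilon_k)_{k\ge1}$ are independent random variables with $P(\varepsilon_k=1)=P(\varepsilon_k=-1)=\frac12$; for fixed $n\ge1$ and $f\in C([0,1])$, $\varphi(f)=\varphi_n(f):=\sum_{k=1}^n f\left(\frac kn\right)\frac{\varepsilon_k}{\sqrt n}$. Wick powers: for a random variable $\eta$ with finite moments, $:\eta^m:\;=P_m(\eta)$, where $P_m$ is the polynomial of degree $m$ determined by $P_0(x)=1$, $P_m'(x)=mP_{m-1}(x)$ and $\mathbb{E}P_m(\eta)=0$ for $m\ge1$. $:\varphi^{m}(f):$ is the $m$-th Wick power of $\eta=\varphi(f)$. Diagrams: to each factor $:\varphi^{n_i}(f_i):$ one assigns $n_i$ vertices $f_i^1,\dots,f_i^{n_i}$. Let $\Pi$ be the set of all partitions of $\{1,\dots,K\}$ in which every block has even cardinality and no block consists only of numbers of vertices belonging to one and the same factor $:\varphi^{n_i}(f_i):$. A diagram $G$ is a choice of a partition $S\in\Pi$ together with, for every block $s\in S$, an ordering (traversal) of its elements $(a_1,\dots,a_{|s|})$ such that $a_1=\min s$ (the remaining elements being in arbitrary order). If $\Pi$ is empty, the sum over diagrams is $0$. *)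

theory Defs
  imports "HOL-Probability.Probability" "HOL-Computational_Algebra.Polynomial"
begin

locale bernoulli_noise = prob_space M for M :: "'a measure" +
  fixes \<epsilon> :: "nat \<Rightarrow> 'a \<Rightarrow> real"
  assumes indep: "indep_vars (\<lambda>_. borel) \<epsilon> {1..}"
    and prob_pos: "\<And>k. k \<ge> 1 \<Longrightarrow> prob {\<omega> \<in> space M. \<epsilon> k \<omega> = 1} = 1 / 2"
    and prob_neg: "\<And>k. k \<ge> 1 \<Longrightarrow> prob {\<omega> \<in> space M. \<epsilon> k \<omega> = - 1} = 1 / 2"

definition noise_field :: "(nat \<Rightarrow> 'a \<Rightarrow> real) \<Rightarrow> nat \<Rightarrow> (real \<Rightarrow> real) \<Rightarrow> 'a \<Rightarrow> real" where
  "noise_field \<epsilon> n f \<omega> = (\<Sum>k = 1..n. f (real k / real n) * (\<epsilon> k \<omega> / sqrt (real n)))"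

definition wick_system :: "'a measure \<Rightarrow> ('a \<Rightarrow> real) \<Rightarrow> (nat \<Rightarrow> real poly) \<Rightarrow> bool" where
  "wick_system M \<eta> P \<longleftrightarrow>
     (\<forall>m. degree (P m) = m) \<and> P 0 = 1 \<and>
     (\<forall>m\<ge>1. pderiv (P m) = smult (real m) (P (m - 1)) \<and>
            (LINT \<omega>|M. poly (P m) (\<eta> \<omega>)) = 0)"

definition wick_poly :: "'a measure \<Rightarrow> ('a \<Rightarrow> real) \<Rightarrow> nat \<Rightarrow> real poly" where
  "wick_poly M \<eta> = (THE P. wick_system M \<eta> P)"

definition wick_power :: "'a measure \<Rightarrow> ('a \<Rightarrow> real) \<Rightarrow> nat \<Rightarrow> 'a \<Rightarrow> real" where
  "wick_power M \<eta> m \<omega> = poly (wick_poly M \<eta> m) (\<eta> \<omega>)"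

text \<open>Existence and uniqueness of the Wick polynomials, so that the definite description
  above denotes whenever the random variable has finite moments.\<close>

lemma ex_poly_antiderivative: "\<exists>q :: real poly. pderiv q = p"
proof
  have pderiv_sum: "pderiv (sum g A) = (\<Sum>i\<in>A. pderiv (g i))"
    for g :: "nat \<Rightarrow> real poly" and A
    by (induction A rule: infinite_finite_induct) (auto simp: pderiv_add)
  have "pderiv (monom (coeff p i / real (Suc i)) (Suc i)) = monom (coeff p i) i" for i
    by (simp add: pderiv_monom del: of_nat_Suc)
  then show "pderiv (\<Sum>i\<le>degree p. monom (coeff p i / real (Suc i)) (Suc i)) = p"
    by (simp add: pderiv_sum poly_as_sum_of_monoms del: of_nat_Suc)
qed

lemma pderiv_eq_imp_const:
  fixes p q :: "real poly"
  assumes "pderiv p = pderiv q"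
  obtains c where "p = q + [:c:]"
proof -
  have "pderiv (p - q) = 0" using assms by (simp add: pderiv_diff)
  then have "degree (p - q) = 0" by (simp add: pderiv_eq_0_iff)
  then obtain c where "p - q = [:c:]" by (rule degree_eq_zeroE)
  then have "p = q + [:c:]" by (simp add: algebra_simps)
  then show thesis by (rule that)
qed

lemma (in prob_space) ex1_wick_system:
  assumes moments: "\<And>k :: nat. integrable M (\<lambda>\<omega>. \<eta> \<omega> ^ k :: real)"
  shows "\<exists>!P. wick_system M \<eta> P"
proof (rule ex_ex1I)
  have int: "integrable M (\<lambda>\<omega>. poly p (\<eta> \<omega>))" for p
    unfolding poly_altdef by (intro Bochner_Integration.integrable_sum integrable_mult_right moments)
  have step: "\<exists>q. (degree q = Suc m \<and> (LINT \<omega>|M. poly q (\<eta> \<omega>)) = 0) \<and>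
      pderiv q = smult (real (Suc m)) p" if "degree p = m \<and> p \<noteq> 0" for p m
  proof -
    obtain q where q: "pderiv q = smult (real (Suc m)) p" using ex_poly_antiderivative by blast
    define r where "r = q + [:- (LINT \<omega>|M. poly q (\<eta> \<omega>)):]"
    have r: "pderiv r = smult (real (Suc m)) p" by (simp add: r_def pderiv_add pderiv_pCons q)
    have "degree r - 1 = m" using degree_pderiv[of r] r that by simp
    moreover have "degree r \<noteq> 0"
      using r that by (metis pderiv_eq_0_iff smult_eq_0_iff of_nat_eq_0_iff nat.distinct(1))
    moreover have "(LINT \<omega>|M. poly r (\<eta> \<omega>)) = 0"
      by (simp add: r_def int prob_space)
    ultimately show ?thesis using r by (intro exI[of _ r]) auto
  qed
  have "\<exists>P. \<forall>m. (degree (P m) = m \<and> P m \<noteq> 0 \<and>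
        (m = 0 \<longrightarrow> P m = 1) \<and> (m \<ge> 1 \<longrightarrow> (LINT \<omega>|M. poly (P m) (\<eta> \<omega>)) = 0)) \<and>
      pderiv (P (Suc m)) = smult (real (Suc m)) (P m)"
  proof (rule dependent_nat_choice)
    show "\<exists>x. degree x = 0 \<and> x \<noteq> 0 \<and> (0 = (0::nat) \<longrightarrow> x = 1) \<and>
        (0 \<ge> (1::nat) \<longrightarrow> (LINT \<omega>|M. poly x (\<eta> \<omega>)) = 0)"
      by (intro exI[of _ 1]) auto
  next
    fix x m
    assume "degree x = m \<and> x \<noteq> 0 \<and> (m = 0 \<longrightarrow> x = 1) \<and>
        (m \<ge> 1 \<longrightarrow> (LINT \<omega>|M. poly x (\<eta> \<omega>)) = 0)"
    then obtain q where "degree q = Suc m" "(LINT \<omega>|M. poly q (\<eta> \<omega>)) = 0"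
      "pderiv q = smult (real (Suc m)) x" using step[of x m] by auto
    then show "\<exists>y. (degree y = Suc m \<and> y \<noteq> 0 \<and> (Suc m = 0 \<longrightarrow> y = 1) \<and>
        (Suc m \<ge> 1 \<longrightarrow> (LINT \<omega>|M. poly y (\<eta> \<omega>)) = 0)) \<and>
        pderiv y = smult (real (Suc m)) x"
      by (intro exI[of _ q]) auto
  qed
  then obtain P where P: "\<And>m. degree (P m) = m" "P 0 = 1"
      "\<And>m. m \<ge> 1 \<Longrightarrow> (LINT \<omega>|M. poly (P m) (\<eta> \<omega>)) = 0"
      "\<And>m. pderiv (P (Suc m)) = smult (real (Suc m)) (P m)" by metis
  have "pderiv (P m) = smult (real m) (P (m - 1))" if "m \<ge> 1" for m
    using P(4)[of "m - 1"] that by simp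
  then show "\<exists>P. wick_system M \<eta> P"
    using P(1-3) unfolding wick_system_def by blast
next
  have int: "integrable M (\<lambda>\<omega>. poly p (\<eta> \<omega>))" for p
    unfolding poly_altdef by (intro Bochner_Integration.integrable_sum integrable_mult_right moments)
  fix P Q assume P: "wick_system M \<eta> P" and Q: "wick_system M \<eta> Q"
  have "P m = Q m" for m
  proof (induction m)
    case 0
    then show ?case using P Q by (simp add: wick_system_def)
  next
    case (Suc m)
    have "pderiv (P (Suc m)) = smult (real (Suc m)) (P m)"
      "pderiv (Q (Suc m)) = smult (real (Suc m)) (Q m)"
      using P Q unfolding wick_system_def by (metis diff_Suc_1 le_add1 plus_1_eq_Suc)+
    then obtain c where c: "P (Suc m) = Q (Suc m) + [:c:]"
      using Suc by (metis pderiv_eq_imp_const)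
    have "(LINT \<omega>|M. poly (P (Suc m)) (\<eta> \<omega>)) = 0" "(LINT \<omega>|M. poly (Q (Suc m)) (\<eta> \<omega>)) = 0"
      using P Q by (simp_all add: wick_system_def)
    then have "c = 0" by (simp add: c int prob_space)
    then show ?case using c by simp
  qed
  then show "P = Q" by blast
qed

lemma (in prob_space) wick_system_wick_poly:
  assumes "\<And>k :: nat. integrable M (\<lambda>\<omega>. \<eta> \<omega> ^ k :: real)"
  shows "wick_system M \<eta> (wick_poly M \<eta>)"
  unfolding wick_poly_def using ex1_wick_system[OF assms] by (rule theI')

text \<open>The vertex \<open>f_i^j\<close> is encoded as the pair \<open>(i, j)\<close>; \<open>d i\<close> is the order of the
  \<open>i\<close>-th Wick power.\<close>

definition factor_vertices :: "(nat \<Rightarrow> nat) \<Rightarrow> nat \<Rightarrow> (nat \<times> nat) set" where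
  "factor_vertices d i = {i} \<times> {1..d i}"

definition vertices :: "nat \<Rightarrow> (nat \<Rightarrow> nat) \<Rightarrow> (nat \<times> nat) set" where
  "vertices N d = (\<Union>i\<in>{1..N}. factor_vertices d i)"

definition diagram_partitions ::
    "nat \<Rightarrow> (nat \<Rightarrow> nat) \<Rightarrow> (nat \<times> nat \<Rightarrow> nat) \<Rightarrow> nat set set set" where
  "diagram_partitions N d \<psi> =
     {S. partition_on {1..(\<Sum>i = 1..N. d i)} S \<and>
         (\<forall>s\<in>S. even (card s)) \<and>
         (\<forall>s\<in>S. \<not> (\<exists>i\<in>{1..N}. s \<subseteq> \<psi> ` factor_vertices d i))}"

definition block_orderings :: "nat set \<Rightarrow> nat list set" where
  "block_orderings s = {a. distinct a \<and> set a = s \<and> hd a = Min s}"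

text \<open>A diagram is a partition together with a choice of an ordering for each of its blocks.
  The choice function is extensional, so distinct elements of this set are distinct diagrams.\<close>

definition diagrams ::
    "nat \<Rightarrow> (nat \<Rightarrow> nat) \<Rightarrow> (nat \<times> nat \<Rightarrow> nat) \<Rightarrow> (nat set set \<times> (nat set \<Rightarrow> nat list)) set" where
  "diagrams N d \<psi> = (SIGMA S : diagram_partitions N d \<psi>. \<Pi>\<^sub>E s\<in>S. block_orderings s)"

definition ascents :: "nat list \<Rightarrow> nat" where
  "ascents a = card {r. Suc r < length a \<and> a ! r \<le> a ! Suc r}"

text \<open>A block of a diagram has at least two elements and its ordering starts with the minimum,
  so \<open>ascents (a s) \<ge> 1\<close> and the subtraction of natural numbers below does not truncate.\<close>

definition diagram_value ::
    "nat \<Rightarrow> nat \<Rightarrow> (nat \<Rightarrow> nat) \<Rightarrow> (nat \<Rightarrow> real \<Rightarrow> real) \<Rightarrow> (nat \<times> nat \<Rightarrow> nat) \<Rightarrow>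
     nat set set \<times> (nat set \<Rightarrow> nat list) \<Rightarrow> real" where
  "diagram_value n N d f \<psi> = (\<lambda>(S, a).
     \<Prod>s\<in>S. (- 1) ^ (ascents (a s) - 1) *
       (\<Sum>k = 1..n. \<Prod>v\<in>{v \<in> vertices N d. \<psi> v \<in> s}.
          f (fst v) (real k / real n) * (1 / sqrt (real n))))"

end

theory Submission
  imports Defs "HOL-Computational_Algebra.Formal_Power_Series" "HOL-Combinatorics.Multiset_Permutations"
begin

text \<open>The expectation \<open>G V\<close> of the Wick product attached to a set \<open>V\<close> of vertices satisfies
  \<open>G (insert v V) = (\<Sum>D \<subseteq> V. C (insert v D) * G (V - D))\<close>, where \<open>C\<close> is the joint cumulant, replaced
  by \<open>0\<close> on sets that lie within one factor; iterating this gives the sum over partitions. The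
  recursion comes from \<open>E[\<epsilon>\<^sub>k F(\<epsilon>)]\<close>: averaging over the sign \<open>\<epsilon>\<^sub>k\<close> and expanding \<open>F\<close>, a product of
  Appell polynomials, by their addition formula reduces it to \<open>sinh = tanh * cosh\<close>, so that the
  Taylor coefficients of \<open>tanh\<close> appear; the recursion of the Wick polynomials
  subtracts exactly the terms internal to the factor of \<open>v\<close>. Finally, the alternating sum over
  permutations by ascents satisfies, on splitting at the maximum, the differential equation
  \<open>u' = 1 - u\<^sup>2\<close> of \<open>tanh\<close>, and so equals the cumulants of a random sign.\<close>

subsection \<open>Sums over subsets and over partitions\<close>

lemma sum_Pow_card:
  fixes h :: "nat \<Rightarrow> 'b::comm_semiring_1"
  assumes "finite A"
  shows "(\<Sum>B\<in>Pow A. h (card B)) = (\<Sum>j\<le>card A. of_nat (card A choose j) * h j)"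
proof -
  have "(\<Sum>B\<in>Pow A. h (card B)) = (\<Sum>j\<le>card A. \<Sum>B\<in>{B \<in> Pow A. card B = j}. h (card B))"
    using assms by (intro sum.group [symmetric]) (auto intro: card_mono)
  also have "\<dots> = (\<Sum>j\<le>card A. of_nat (card A choose j) * h j)"
  proof (intro sum.cong refl)
    fix j
    have "(\<Sum>B\<in>{B \<in> Pow A. card B = j}. h (card B)) = (\<Sum>B\<in>{B. B \<subseteq> A \<and> card B = j}. h j)"
      by (intro sum.cong) auto
    also have "\<dots> = of_nat (card A choose j) * h j"
      using n_subsets[OF assms, of j] by simp
    finally show "(\<Sum>B\<in>{B \<in> Pow A. card B = j}. h (card B)) = of_nat (card A choose j) * h j" .
  qed
  finally show ?thesis .
qed

lemma sum_Pow_Un: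
  assumes "A \<inter> B = {}"
  shows "(\<Sum>X\<in>Pow (A \<union> B). h X) = (\<Sum>X\<in>Pow A. \<Sum>Y\<in>Pow B. h (X \<union> Y))"
  unfolding sum.cartesian_product
proof (rule sum.reindex_bij_witness[of _ "\<lambda>(X, Y). X \<union> Y" "\<lambda>X. (X \<inter> A, X \<inter> B)"], goal_cases)
  case (1 X)
  then show ?case by auto
next
  case (5 X)
  then have "X \<inter> A \<union> X \<inter> B = X" by auto
  then show ?case by simp
qed (use assms in auto)

text \<open>Both sides run over ordered pairs of disjoint subsets of \<open>V\<close>; the right
  side groups them by their union. This is the rearrangement behind nested subset
  expansions.\<close>

lemma sum_Pow_Pow_Diff:
  assumes "finite V"
  shows "(\<Sum>D\<in>Pow V. \<Sum>A\<in>Pow (V - D). h D A) = (\<Sum>A\<in>Pow V. \<Sum>D\<in>Pow A. h D (A - D))"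
proof -
  have "(\<Sum>D\<in>Pow V. \<Sum>A\<in>Pow (V - D). h D A) = (\<Sum>(D, A)\<in>(SIGMA D:Pow V. Pow (V - D)). h D A)"
    using assms by (intro sum.Sigma) (auto intro: finite_subset)
  also have "\<dots> = (\<Sum>(A, D)\<in>(SIGMA A:Pow V. Pow A). h D (A - D))"
    by (rule sum.reindex_bij_witness[of _ "\<lambda>(A, D). (D, A - D)" "\<lambda>(D, A). (D \<union> A, D)"])
       (auto intro!: arg_cong[of _ _ "h _"])
  also have "\<dots> = (\<Sum>A\<in>Pow V. \<Sum>D\<in>Pow A. h D (A - D))"
    using assms by (intro sum.Sigma[symmetric]) (auto intro: finite_subset)
  finally show ?thesis .
qed

text \<open>Distributivity: choosing a subset of every fibre of \<open>c\<close> over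
  \<open>I\<close> amounts to choosing one subset of their union, whose traces on the fibres are the
  chosen sets.\<close>

lemma prod_sum_Pow_fibres:
  fixes h :: "'i \<Rightarrow> 'b set \<Rightarrow> 'c::comm_semiring_1"
  assumes "finite I"
  shows "(\<Prod>i\<in>I. \<Sum>A\<in>Pow {v \<in> V. c v = i}. h i A) =
    (\<Sum>A\<in>Pow {v \<in> V. c v \<in> I}. \<Prod>i\<in>I. h i {v \<in> A. c v = i})"
  using assms
proof (induction I rule: finite_induct)
  case (insert x I)
  have *: "{v \<in> V. c v \<in> insert x I} = {v \<in> V. c v = x} \<union> {v \<in> V. c v \<in> I}"
    by auto
  have "(\<Sum>A\<in>Pow {v \<in> V. c v \<in> insert x I}. \<Prod>i\<in>insert x I. h i {v \<in> A. c v = i}) =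
    (\<Sum>X\<in>Pow {v \<in> V. c v = x}. \<Sum>Y\<in>Pow {v \<in> V. c v \<in> I}.
      \<Prod>i\<in>insert x I. h i {v \<in> X \<union> Y. c v = i})"
    unfolding * using insert.hyps by (subst sum_Pow_Un) auto
  also have "\<dots> = (\<Sum>X\<in>Pow {v \<in> V. c v = x}. \<Sum>Y\<in>Pow {v \<in> V. c v \<in> I}.
      h x X * (\<Prod>i\<in>I. h i {v \<in> Y. c v = i}))"
  proof (intro sum.cong refl)
    fix X Y assume XY: "X \<in> Pow {v \<in> V. c v = x}" "Y \<in> Pow {v \<in> V. c v \<in> I}"
    have "{v \<in> X \<union> Y. c v = x} = X" using XY insert.hyps by auto
    moreover have "{v \<in> X \<union> Y. c v = i} = {v \<in> Y. c v = i}" if "i \<in> I" for i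
      using XY insert.hyps that by auto
    ultimately show "(\<Prod>i\<in>insert x I. h i {v \<in> X \<union> Y. c v = i}) =
        h x X * (\<Prod>i\<in>I. h i {v \<in> Y. c v = i})"
      using insert.hyps by simp
  qed
  also have "\<dots> = (\<Prod>i\<in>insert x I. \<Sum>A\<in>Pow {v \<in> V. c v = i}. h i A)"
    using insert by (simp add: sum_product)
  finally show ?case ..
qed simp

text \<open>A partition of \<open>insert v V\<close> is determined by the block
  \<open>insert v D\<close> of \<open>v\<close> and a partition of what remains,
  \<open>V - D\<close>.\<close>

lemma sum_partition_on_insert:
  fixes C :: "'b set \<Rightarrow> 'c::comm_semiring_1"
  assumes "finite V" "v \<notin> V"
  shows "(\<Sum>S | partition_on (insert v V) S. \<Prod>s\<in>S. C s) =
    (\<Sum>D\<in>Pow V. C (insert v D) * (\<Sum>S | partition_on (V - D) S. \<Prod>s\<in>S. C s))"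
proof -
  have fin: "finite {S. partition_on A S}" if "A \<subseteq> V" for A
    using that assms(1) by (intro finitely_many_partition_on) (rule finite_subset)
  have "(\<Sum>D\<in>Pow V. C (insert v D) * (\<Sum>S | partition_on (V - D) S. \<Prod>s\<in>S. C s)) =
    (\<Sum>(D, S)\<in>(SIGMA D:Pow V. {S. partition_on (V - D) S}). C (insert v D) * (\<Prod>s\<in>S. C s))"
    unfolding sum_distrib_left
    using assms fin by (intro sum.Sigma) auto
  also have "\<dots> = (\<Sum>S | partition_on (insert v V) S. \<Prod>s\<in>S. C s)"
  \<comment> \<open>The inverse map recovers the block of \<open>v\<close> by a definite
    description, which denotes because blocks are disjoint.\<close>
  proof (rule sum.reindex_bij_witness[of _
      "\<lambda>S. ((THE s. s \<in> S \<and> v \<in> s) - {v}, S - {THE s. s \<in> S \<and> v \<in> s})"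
      "\<lambda>(D, S). insert (insert v D) S"], goal_cases)
    case (1 DS)
    then obtain D S where [simp]: "DS = (D, S)" and D: "D \<subseteq> V" and S: "partition_on (V - D) S"
      by auto
    have v: "v \<notin> s" if "s \<in> S" for s using partition_onD1[OF S] that assms by auto
    then have "(THE s. s \<in> insert (insert v D) S \<and> v \<in> s) = insert v D" by (intro the_equality) auto
    moreover have "insert v D \<notin> S" using v by auto
    moreover have "v \<notin> D" using D assms by auto
    ultimately show ?case by auto
  next
    case (2 DS)
    then obtain D S where [simp]: "DS = (D, S)" and D: "D \<subseteq> V" and S: "partition_on (V - D) S"
      by auto
    have "disjnt (insert v D) (\<Union>S)" using partition_onD1[OF S] assms by (auto simp: disjnt_def)
    moreover have "insert v V - insert v D = V - D" using assms by auto
    ultimately show ?case using D S by (auto simp: partition_on_insert)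
  next
    case (3 S)
    then have S: "partition_on (insert v V) S" by simp
    then obtain s where s: "s \<in> S" "v \<in> s" using partition_onD1 by fastforce
    then have "(THE s. s \<in> S \<and> v \<in> s) = s"
      using partition_onD2[OF S] by (intro the_equality) (auto simp: disjoint_def)
    then show ?case using s by (auto simp: insert_absorb)
  next
    case (4 S)
    then have S: "partition_on (insert v V) S" by simp
    then obtain s where s: "s \<in> S" "v \<in> s" using partition_onD1 by fastforce
    then have *: "(THE s. s \<in> S \<and> v \<in> s) = s"
      using partition_onD2[OF S] by (intro the_equality) (auto simp: disjoint_def)
    have "disjnt s (\<Union>(S - {s}))"
      using partition_onD2[OF S] s by (auto simp: disjoint_def disjnt_def)
    then have "partition_on (insert v V - s) (S - {s}) \<and> s \<subseteq> insert v V"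
      using partition_on_insert[of s "S - {s}" "insert v V"] S s by (simp add: insert_absorb)
    moreover have "insert v V - s = V - (s - {v})" using s assms by auto
    ultimately show ?case using * by auto
  next
    case (5 DS)
    then obtain D S where [simp]: "DS = (D, S)" and D: "D \<subseteq> V" and S: "partition_on (V - D) S"
      by auto
    have "finite S" using S assms(1) finite_elements by blast
    moreover have "insert v D \<notin> S" using partition_onD1[OF S] assms by auto
    ultimately show ?case by simp
  qed
  finally show ?thesis ..
qed

text \<open>Together with \<open>G {} = 1\<close> the recursion determines \<open>G\<close>, and the
  sum over partitions obeys the same recursion by \<open>sum_partition_on_insert\<close>. The
  recursion is demanded only inside \<open>V\<close>, a condition that passes to subsets, so
  induction over proper subsets applies.\<close>

lemma partition_expansion:
  fixes C G :: "'b set \<Rightarrow> 'c::comm_semiring_1"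
  assumes "finite V" and "G {} = 1"
    and rec: "\<And>v W. insert v W \<subseteq> V \<Longrightarrow> v \<notin> W \<Longrightarrow>
      G (insert v W) = (\<Sum>D\<in>Pow W. C (insert v D) * G (W - D))"
  shows "G V = (\<Sum>S | partition_on V S. \<Prod>s\<in>S. C s)"
  using assms(1) rec
proof (induction V rule: finite_psubset_induct)
  case (psubset V)
  show ?case
  proof (cases "V = {}")
    case True
    then show ?thesis using assms(2) by (simp add: partition_on_empty)
  next
    case False
    then obtain v W where V: "V = insert v W" "v \<notin> W" by (meson Set.set_insert ex_in_conv)
    have "G V = (\<Sum>D\<in>Pow W. C (insert v D) * G (W - D))" using V psubset.prems by auto
    also have "\<dots> = (\<Sum>D\<in>Pow W. C (insert v D) * (\<Sum>S | partition_on (W - D) S. \<Prod>s\<in>S. C s))"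
    proof (intro sum.cong refl arg_cong2[of _ _ _ _ "(*)"])
      fix D
      show "G (W - D) = (\<Sum>S | partition_on (W - D) S. \<Prod>s\<in>S. C s)"
        by (intro psubset.IH) (use V psubset.prems in auto)
    qed
    also have "\<dots> = (\<Sum>S | partition_on V S. \<Prod>s\<in>S. C s)"
      using V psubset.hyps by (simp add: sum_partition_on_insert)
    finally show ?thesis .
  qed
qed

subsection \<open>Signed counts of permutations by ascents\<close>

lemma ascents_Nil [simp]: "ascents [] = 0"
  and ascents_single [simp]: "ascents [x] = 0"
  by (simp_all add: ascents_def)

lemma ascents_Cons_Cons [simp]: "ascents (x # y # zs) = of_bool (x \<le> y) + ascents (y # zs)"
proof -
  have "{r. Suc r < length (x # y # zs) \<and> (x # y # zs) ! r \<le> (x # y # zs) ! Suc r} =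
    (if x \<le> y then {0} else {}) \<union>
    Suc ` {r. Suc r < length (y # zs) \<and> (y # zs) ! r \<le> (y # zs) ! Suc r}" (is "?L = ?R")
  proof (rule set_eqI)
    fix r show "r \<in> ?L \<longleftrightarrow> r \<in> ?R" by (cases r) auto
  qed
  moreover have "finite {r. Suc r < length (y # zs) \<and> (y # zs) ! r \<le> (y # zs) ! Suc r}"
    by (rule finite_subset[of _ "{..<length (y # zs)}"]) auto
  ultimately have "ascents (x # y # zs) = card (if x \<le> y then {0 :: nat} else {}) +
    card (Suc ` {r. Suc r < length (y # zs) \<and> (y # zs) ! r \<le> (y # zs) ! Suc r})"
    unfolding ascents_def by (simp only:) (rule card_Un_disjoint, auto)
  then show ?thesis by (simp add: ascents_def card_image)
qed

lemma ascents_Cons_max: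
  assumes "\<forall>x\<in>set R. x < m"
  shows "ascents (m # R) = ascents R"
  using assms by (cases R) auto

text \<open>The step into the maximum, if there is one, is an ascent and the step out of it a
  descent; the two sides contribute independently.\<close>

lemma ascents_append_max:
  assumes "\<forall>x\<in>set L. x < m" "\<forall>x\<in>set R. x < m"
  shows "ascents (L @ m # R) = ascents L + of_bool (L \<noteq> []) + ascents R"
  using assms
proof (induction L rule: induct_list012)
  case 1
  then show ?case by (simp add: ascents_Cons_max)
next
  case (2 x)
  then show ?case by (simp add: ascents_Cons_max)
next
  case (3 x y zs)
  then show ?case by simp
qed

lemma sum_permutations_of_set_max:
  fixes h :: "'b::linorder list \<Rightarrow> 'c::comm_monoid_add"
  assumes "finite A" "\<forall>x\<in>A. x < m"
  shows "(\<Sum>a\<in>permutations_of_set (insert m A). h a) =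
    (\<Sum>B\<in>Pow A. \<Sum>L\<in>permutations_of_set B. \<Sum>R\<in>permutations_of_set (A - B). h (L @ m # R))"
proof -
  have fin: "finite B" if "B \<subseteq> A" for B using that assms(1) by (rule finite_subset)
  have "(\<Sum>B\<in>Pow A. \<Sum>L\<in>permutations_of_set B. \<Sum>R\<in>permutations_of_set (A - B). h (L @ m # R)) =
    (\<Sum>(B, L, R)\<in>(SIGMA B:Pow A. permutations_of_set B \<times> permutations_of_set (A - B)).
      h (L @ m # R))"
    using assms by (simp add: sum.cartesian_product sum.Sigma fin)
  also have "\<dots> = (\<Sum>a\<in>permutations_of_set (insert m A). h a)"
  \<comment> \<open>The inverse map cuts the list at the only occurrence of
    \<open>m\<close>.\<close>
  proof (rule sum.reindex_bij_witness[of _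
      "\<lambda>a. (set (takeWhile (\<lambda>x. x \<noteq> m) a), takeWhile (\<lambda>x. x \<noteq> m) a, tl (dropWhile (\<lambda>x. x \<noteq> m) a))"
      "\<lambda>(B, L, R). L @ m # R"], goal_cases)
    case (1 b)
    then obtain B L R where [simp]: "b = (B, L, R)" and B: "B \<subseteq> A" "set L = B" "set R = A - B"
      by (auto simp: permutations_of_set_def)
    have m: "m \<notin> set L" "m \<notin> A" using B assms by auto
    then have "takeWhile (\<lambda>x. x \<noteq> m) (L @ m # R) = L" "dropWhile (\<lambda>x. x \<noteq> m) (L @ m # R) = m # R"
      by (subst takeWhile_append2 dropWhile_append2; auto)+
    then show ?case using B by simp
  next
    case (2 b)
    moreover have "m \<notin> A" using assms by auto
    ultimately show ?case by (auto simp: permutations_of_set_def)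
  next
    case (3 a)
    then have "m \<in> set a" by (auto simp: permutations_of_set_def)
    then obtain L R where "a = L @ m # R" "m \<notin> set L" by (meson split_list_first)
    moreover from this have "takeWhile (\<lambda>x. x \<noteq> m) (L @ m # R) = L"
      "dropWhile (\<lambda>x. x \<noteq> m) (L @ m # R) = m # R"
      by (subst takeWhile_append2 dropWhile_append2; auto)+
    ultimately show ?case by simp
  next
    case (4 a)
    then have "m \<in> set a" by (auto simp: permutations_of_set_def)
    then obtain L R where a: "a = L @ m # R" "m \<notin> set L" by (meson split_list_first)
    moreover from this have *: "takeWhile (\<lambda>x. x \<noteq> m) (L @ m # R) = L"
      "dropWhile (\<lambda>x. x \<noteq> m) (L @ m # R) = m # R"
      by (subst takeWhile_append2 dropWhile_append2; auto)+
    have "distinct (L @ m # R)" "set (L @ m # R) = insert m A"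
      using 4 a by (auto simp: permutations_of_set_def)
    moreover have "m \<notin> A" using assms by auto
    ultimately have "set L \<subseteq> A" "set R = A - set L" by auto
    then show ?case using \<open>distinct (L @ m # R)\<close> by (simp add: a * permutations_of_set_def)
  next
    case (5 b)
    then show ?case by auto
  qed
  finally show ?thesis ..
qed

text \<open>The recursion classifies a permutation by the set of entries to the left of its maximum.\<close>

fun signed_perms :: "nat \<Rightarrow> real" where
  "signed_perms 0 = 1"
| "signed_perms (Suc p) =
    (\<Sum>j\<le>p. real (p choose j) * ((if j = 0 then 1 else - 1) * signed_perms j * signed_perms (p - j)))"

text \<open>Induction on the set by removing its maximum: the ascent into the maximum gives the
  factor \<open>- 1\<close>, which is missing precisely when nothing stands to its left
  (\<open>j = 0\<close>).\<close>

lemma sum_permutations_signed_perms: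
  fixes A :: "nat set"
  assumes "finite A"
  shows "(\<Sum>a\<in>permutations_of_set A. (- 1) ^ ascents a) = signed_perms (card A)"
  using assms
proof (induction A rule: finite_psubset_induct)
  case (psubset A)
  show ?case
  proof (cases "A = {}")
    case False
    define m where "m = Max A"
    define A' where "A' = A - {m}"
    have A: "A = insert m A'" "m \<notin> A'" "finite A'"
      using Max_in[OF psubset.hyps(1) False] psubset.hyps by (auto simp: A'_def m_def)
    have less: "x < m" if "x \<in> A'" for x
      using that Max_ge[OF psubset.hyps(1), of x] by (auto simp: A'_def m_def order_less_le)
    have "(\<Sum>a\<in>permutations_of_set A. (- 1) ^ ascents a :: real) =
      (\<Sum>B\<in>Pow A'. \<Sum>L\<in>permutations_of_set B. \<Sum>R\<in>permutations_of_set (A' - B).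
        (- 1) ^ ascents (L @ m # R))"
      unfolding A(1) using less A by (intro sum_permutations_of_set_max) auto
    also have "\<dots> = (\<Sum>B\<in>Pow A'. (if card B = 0 then 1 else - 1) *
      signed_perms (card B) * signed_perms (card A' - card B))"
    proof (intro sum.cong refl)
      fix B assume "B \<in> Pow A'"
      then have B: "B \<subseteq> A'" by simp
      have fB: "finite B" using B A(3) by (rule finite_subset)
      have "(\<Sum>L\<in>permutations_of_set B. \<Sum>R\<in>permutations_of_set (A' - B).
          (- 1) ^ ascents (L @ m # R) :: real) =
        (\<Sum>L\<in>permutations_of_set B. \<Sum>R\<in>permutations_of_set (A' - B).
          (if card B = 0 then 1 else - 1) * ((- 1) ^ ascents L * (- 1) ^ ascents R))"
      proof (intro sum.cong refl)
        fix L R assume "L \<in> permutations_of_set B" "R \<in> permutations_of_set (A' - B)"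
        then have LR: "set L = B" "set R = A' - B" by (auto simp: permutations_of_set_def)
        have "L \<noteq> [] \<longleftrightarrow> card B \<noteq> 0" using LR fB by auto
        then show "(- 1) ^ ascents (L @ m # R) =
          (if card B = 0 then 1 else - 1) * ((- 1) ^ ascents L * (- 1) ^ ascents R :: real)"
          using less LR B by (subst ascents_append_max) (auto simp: power_add)
      qed
      also have "\<dots> = (if card B = 0 then 1 else - 1) *
        ((\<Sum>L\<in>permutations_of_set B. (- 1) ^ ascents L) *
         (\<Sum>R\<in>permutations_of_set (A' - B). (- 1) ^ ascents R))"
        unfolding sum_product by (simp only: sum_distrib_left)
      also have "\<dots> = (if card B = 0 then 1 else - 1) *
        (signed_perms (card B) * signed_perms (card (A' - B)))"
        using B A by (subst (1 2) psubset.IH) auto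
      also have "card (A' - B) = card A' - card B" using B fB by (simp add: card_Diff_subset)
      finally show "(\<Sum>L\<in>permutations_of_set B. \<Sum>R\<in>permutations_of_set (A' - B).
          (- 1) ^ ascents (L @ m # R)) = (if card B = 0 then 1 else - 1) *
          signed_perms (card B) * signed_perms (card A' - card B)"
        by simp
    qed
    also have "\<dots> = signed_perms (card A)"
      using A sum_Pow_card[OF A(3), of "\<lambda>j. (if j = 0 then 1 else - 1) * signed_perms j *
        signed_perms (card A' - j)"] by simp
    finally show ?thesis .
  qed simp
qed

section \<open>The power series of the hyperbolic tangent\<close>

text \<open>\<open>tanh_coeff j\<close> is the \<open>j\<close>-th derivative of \<open>tanh\<close> at \<open>0\<close>, that is, the cumulant of order
  \<open>j + 1\<close> of a random sign.\<close>

definition tanh_coeff :: "nat \<Rightarrow> real" where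
  "tanh_coeff j = (if j = 0 then 0 else signed_perms j)"

definition tanh_fps :: "real fps" where
  "tanh_fps = Abs_fps (\<lambda>j. tanh_coeff j / fact j)"

lemma tanh_fps_nth: "fps_nth tanh_fps j = tanh_coeff j / fact j"
  by (simp add: tanh_fps_def)

text \<open>Since \<open>tanh_coeff\<close> only replaces the constant term by 0, the exponential
  generating function of \<open>signed_perms\<close> is \<open>1 + tanh_fps\<close>; the sign in the
  recursion, positive only for \<open>j = 0\<close>, turns the left factor into
  \<open>1 - tanh_fps\<close>. Hence the recursion reads T' = (1 - T)(1 + T).\<close>

lemma fps_deriv_tanh_fps: "fps_deriv tanh_fps = 1 - tanh_fps ^ 2"
proof -
  have "fps_deriv tanh_fps = (1 - tanh_fps) * (1 + tanh_fps)"
  proof (rule fps_ext)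
    fix p
    have "fps_nth (fps_deriv tanh_fps) p = signed_perms (Suc p) / fact p"
      by (simp add: tanh_fps_nth tanh_coeff_def del: signed_perms.simps of_nat_Suc)
    also have "\<dots> = (\<Sum>j=0..p. fps_nth (1 - tanh_fps) j * fps_nth (1 + tanh_fps) (p - j))"
      unfolding signed_perms.simps sum_divide_distrib atLeast0AtMost
    proof (intro sum.cong refl)
      fix j assume "j \<in> {..p}"
      then have "real (p choose j) / fact p = 1 / (fact j * fact (p - j))"
        by (simp add: binomial_fact)
      moreover have "fps_nth (1 - tanh_fps) j = (if j = 0 then 1 else - 1) * signed_perms j / fact j"
        "fps_nth (1 + tanh_fps) (p - j) = signed_perms (p - j) / fact (p - j)"
        by (simp_all add: tanh_fps_nth tanh_coeff_def)
      ultimately have "real (p choose j) / fact p * ((if j = 0 then 1 else - 1) * signed_perms j *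
          signed_perms (p - j)) = fps_nth (1 - tanh_fps) j * fps_nth (1 + tanh_fps) (p - j)"
        by (simp only:) simp
      then show "real (p choose j) * ((if j = 0 then 1 else - 1) * signed_perms j *
          signed_perms (p - j)) / fact p = fps_nth (1 - tanh_fps) j * fps_nth (1 + tanh_fps) (p - j)"
        by simp
    qed
    also have "\<dots> = fps_nth ((1 - tanh_fps) * (1 + tanh_fps)) p"
      by (simp only: fps_mult_nth)
    finally show "fps_nth (fps_deriv tanh_fps) p = fps_nth ((1 - tanh_fps) * (1 + tanh_fps)) p" .
  qed
  then show ?thesis by (simp add: algebra_simps power2_eq_square)
qed

text \<open>The difference \<open>w\<close> of the two sides satisfies w' = - T w because T' = 1 -
  T^2, and its constant term is 0, so all its coefficients vanish by induction. The exponentials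
  combine to twice cosh and twice sinh.\<close>

lemma tanh_fps_times_cosh:
  "tanh_fps * (fps_exp 1 + fps_exp (- 1)) = fps_exp 1 - fps_exp (- 1)"
proof -
  define w where "w = tanh_fps * (fps_exp 1 + fps_exp (- 1)) - (fps_exp 1 - fps_exp (- 1))"
  have "fps_const (- 1) = (- 1 :: real fps)" by (metis fps_const_1_eq_1 fps_const_neg)
  then have "fps_deriv (fps_exp (- 1 :: real)) = - fps_exp (- 1)"
    by (simp only: fps_exp_deriv) simp
  then have w': "fps_deriv w = - (tanh_fps * w)"
    unfolding w_def fps_deriv_sub fps_deriv_mult fps_deriv_add fps_deriv_tanh_fps
    by (simp add: algebra_simps power2_eq_square)
  have "fps_nth w k = 0" for k
  proof (induction k rule: less_induct)
    case (less k)
    show ?case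
    proof (cases k)
      case 0
      then show ?thesis by (simp add: w_def tanh_fps_nth tanh_coeff_def)
    next
      case (Suc k')
      have "real k * fps_nth w k = - fps_nth (tanh_fps * w) k'"
        using arg_cong[OF w', of "\<lambda>x. fps_nth x k'"] Suc by simp
      also have "\<dots> = 0"
        using less Suc by (auto simp: fps_mult_nth intro!: sum.neutral)
      finally show ?thesis using Suc by simp
    qed
  qed
  then have "w = 0" by (intro fps_ext) simp
  then show ?thesis by (simp add: w_def)
qed

text \<open>The coefficient of order \<open>a\<close> in \<open>tanh_fps_times_cosh\<close>,
  multiplied by \<open>fact a\<close>.\<close>

lemma tanh_coeff_convolution:
  "(\<Sum>j\<le>a. real (a choose j) * (tanh_coeff j * (1 + (- 1) ^ (a - j)))) = 1 - (- 1) ^ a"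
proof -
  have "(\<Sum>j\<le>a. real (a choose j) * (tanh_coeff j * (1 + (- 1) ^ (a - j)))) / fact a =
    fps_nth (tanh_fps * (fps_exp 1 + fps_exp (- 1))) a"
    unfolding sum_divide_distrib atLeast0AtMost fps_mult_nth
  proof (intro sum.cong refl)
    fix j assume "j \<in> {..a}"
    then have "real (a choose j) / fact a = 1 / (fact j * fact (a - j))"
      by (simp add: binomial_fact)
    then have "real (a choose j) / fact a * (tanh_coeff j * (1 + (- 1) ^ (a - j))) =
        fps_nth tanh_fps j * fps_nth (fps_exp 1 + fps_exp (- 1)) (a - j)"
      by (simp only:) (simp add: tanh_fps_nth add_divide_distrib distrib_left)
    then show "real (a choose j) * (tanh_coeff j * (1 + (- 1) ^ (a - j))) / fact a =
        fps_nth tanh_fps j * fps_nth (fps_exp 1 + fps_exp (- 1)) (a - j)"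
      by simp
  qed
  also have "\<dots> = (1 - (- 1) ^ a) / fact a"
    by (simp add: tanh_fps_times_cosh diff_divide_distrib)
  finally show ?thesis by simp
qed

text \<open>This is the oddness of tanh. In the convolution for even \<open>a\<close>, the terms
  with even \<open>j < a\<close> vanish by induction and those with odd \<open>j\<close> because
  \<open>1 + (- 1) ^ (a - j)\<close> is 0; what remains is
  \<open>2 * tanh_coeff a = 0\<close>.\<close>

lemma tanh_coeff_even:
  assumes "even a"
  shows "tanh_coeff a = 0"
  using assms
proof (induction a rule: less_induct)
  case (less a)
  have "(\<Sum>j\<in>{..<a}. real (a choose j) * (tanh_coeff j * (1 + (- 1) ^ (a - j)))) = 0"
    using less by (intro sum.neutral) (auto simp: minus_one_power_iff)
  then show ?case
    using tanh_coeff_convolution[of a] less.prems by (simp add: lessThan_Suc_atMost[symmetric])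
qed

text \<open>The leading minimum is followed by an ascent, which the \<open>- 1\<close> in the
  exponent removes, and the tail is an arbitrary permutation of \<open>s - {Min s}\<close>. An even
  nonempty block leaves a nonempty tail, so the special value \<open>tanh_coeff 0 = 0\<close> does
  not occur.\<close>

lemma sum_block_orderings:
  assumes "finite s" "even (card s)" "s \<noteq> {}"
  shows "(\<Sum>a\<in>block_orderings s. (- 1) ^ (ascents a - 1)) = tanh_coeff (card s - 1)"
proof -
  define m where "m = Min s"
  have m: "m \<in> s" "\<And>x. x \<in> s \<Longrightarrow> m \<le> x" using assms by (auto simp: m_def)
  have "card s \<noteq> 0" using assms by simp
  moreover have "card s \<noteq> 1" using assms(2) by auto
  ultimately have c: "card (s - {m}) = card s - 1" "card s - 1 \<noteq> 0"
    using m by auto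
  have "block_orderings s = (#) m ` permutations_of_set (s - {m})"
  proof (intro equalityI subsetI)
    fix a assume "a \<in> block_orderings s"
    then show "a \<in> (#) m ` permutations_of_set (s - {m})"
      using assms by (cases a) (auto simp: block_orderings_def permutations_of_set_def m_def)
  qed (use m in \<open>auto simp: block_orderings_def permutations_of_set_def m_def\<close>)
  then have "(\<Sum>a\<in>block_orderings s. (- 1) ^ (ascents a - 1)) =
    (\<Sum>a\<in>permutations_of_set (s - {m}). (- 1) ^ (ascents (m # a) - 1) :: real)"
    by (simp add: sum.reindex)
  also have "\<dots> = (\<Sum>a\<in>permutations_of_set (s - {m}). (- 1) ^ ascents a)"
  proof (intro sum.cong refl)
    fix a assume "a \<in> permutations_of_set (s - {m})"
    then have a: "set a = s - {m}" by (auto simp: permutations_of_set_def)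
    have "s - {m} \<noteq> {}" using c by (metis card.empty)
    then obtain x xs where "a = x # xs" using a by (cases a) auto
    then show "(- 1) ^ (ascents (m # a) - 1) = (- 1 :: real) ^ ascents a"
      using a m by auto
  qed
  also have "\<dots> = tanh_coeff (card s - 1)"
    using sum_permutations_signed_perms[of "s - {m}"] assms c by (simp add: tanh_coeff_def)
  finally show ?thesis .
qed

subsection \<open>Appell polynomials with prescribed cumulants\<close>

text \<open>\<open>\<kappa> j\<close> is the cumulant of order \<open>j + 1\<close> of the underlying distribution.\<close>

fun appell_poly :: "(nat \<Rightarrow> real) \<Rightarrow> nat \<Rightarrow> real poly" where
  "appell_poly \<kappa> 0 = 1"
| "appell_poly \<kappa> (Suc m) =
    [:0, 1:] * appell_poly \<kappa> m - (\<Sum>j\<le>m. smult (real (m choose j) * \<kappa> j) (appell_poly \<kappa> (m - j)))"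

lemma pderiv_sum: "pderiv (\<Sum>i\<in>I. p i) = (\<Sum>i\<in>I. pderiv (p i))"
  by (induction I rule: infinite_finite_induct) (auto simp: pderiv_add)

lemma smult_sum_right: "smult a (\<Sum>i\<in>I. p i) = (\<Sum>i\<in>I. smult a (p i))"
  by (induction I rule: infinite_finite_induct) (auto simp: smult_add_right)

text \<open>Differentiating the recursion gives \<open>appell_poly \<kappa> m\<close> from the
  factor \<open>[:0, 1:]\<close>, plus terms that by induction are \<open>m\<close> times the
  recursion one degree lower, that is, \<open>m\<close> times
  \<open>appell_poly \<kappa> m\<close>.\<close>

lemma pderiv_appell_poly:
  "pderiv (appell_poly \<kappa> (Suc m)) = smult (real (Suc m)) (appell_poly \<kappa> m)"
proof (induction m rule: less_induct)
  case (less m)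
  show ?case
  proof (cases m)
    case 0
    then show ?thesis by (simp add: pderiv_diff pderiv_pCons pderiv_smult one_pCons)
  next
    case (Suc k)
    have IH: "pderiv (appell_poly \<kappa> (Suc i)) = smult (real (Suc i)) (appell_poly \<kappa> i)" if "i \<le> k" for i
      using less.IH Suc that by simp
    have "pderiv (\<Sum>j\<le>m. smult (real (m choose j) * \<kappa> j) (appell_poly \<kappa> (m - j))) =
      (\<Sum>j\<le>Suc k. smult (real (Suc k choose j) * \<kappa> j) (pderiv (appell_poly \<kappa> (Suc k - j))))"
      unfolding Suc by (simp only: pderiv_sum pderiv_smult)
    \<comment> \<open>The last term, \<open>j = Suc k\<close>, contains the derivative of a
      constant.\<close>
    also have "\<dots> = (\<Sum>j\<le>k. smult (real (Suc k choose j) * \<kappa> j) (pderiv (appell_poly \<kappa> (Suc k - j))))"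
      by (simp add: pderiv_1 del: appell_poly.simps(2) binomial_Suc_Suc)
    also have "\<dots> = (\<Sum>j\<le>k. smult (real (Suc k)) (smult (real (k choose j) * \<kappa> j) (appell_poly \<kappa> (k - j))))"
    proof (intro sum.cong refl)
      fix j assume "j \<in> {..k}"
      then have j: "j \<le> k" by simp
      have "real (Suc k choose j) * real (Suc (k - j)) = real (Suc k) * real (k choose j)"
        using binomial_absorb_comp[of "Suc k" j] j
        by (metis Suc_diff_le diff_Suc_1 mult.commute of_nat_mult)
      then have "real (Suc k choose j) * \<kappa> j * real (Suc (k - j)) = real (Suc k) * (real (k choose j) * \<kappa> j)"
        by (metis mult.assoc mult.commute)
      then show "smult (real (Suc k choose j) * \<kappa> j) (pderiv (appell_poly \<kappa> (Suc k - j))) =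
          smult (real (Suc k)) (smult (real (k choose j) * \<kappa> j) (appell_poly \<kappa> (k - j)))"
        using j IH[of "k - j"] by (simp only: Suc_diff_le smult_smult diff_le_self)
    qed
    also have "\<dots> = smult (real (Suc k)) (\<Sum>j\<le>k. smult (real (k choose j) * \<kappa> j) (appell_poly \<kappa> (k - j)))"
      by (simp add: smult_sum_right)
    finally have sum: "pderiv (\<Sum>j\<le>m. smult (real (m choose j) * \<kappa> j) (appell_poly \<kappa> (m - j))) =
      smult (real (Suc k)) ([:0, 1:] * appell_poly \<kappa> k - appell_poly \<kappa> (Suc k))"
      by simp
    have "pderiv (appell_poly \<kappa> (Suc m)) = appell_poly \<kappa> m + [:0, 1:] * pderiv (appell_poly \<kappa> m) -
      pderiv (\<Sum>j\<le>m. smult (real (m choose j) * \<kappa> j) (appell_poly \<kappa> (m - j)))"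
      by (simp add: pderiv_diff pderiv_mult pderiv_pCons del: pderiv_sum)
    also have "\<dots> = appell_poly \<kappa> m + smult (real m) (appell_poly \<kappa> m)"
      unfolding sum unfolding Suc IH[OF order_refl]
      by (simp add: smult_diff_right del: appell_poly.simps(2))
    also have "\<dots> = smult (real (Suc m)) (appell_poly \<kappa> m)"
      using smult_add_left[of 1 "real m" "appell_poly \<kappa> m"] by simp
    finally show ?thesis .
  qed
qed

lemma degree_appell_poly: "degree (appell_poly \<kappa> m) = m"
proof -
  have "degree (appell_poly \<kappa> m) = m \<and> appell_poly \<kappa> m \<noteq> 0"
  proof (induction m)
    case (Suc m)
    have "pderiv (appell_poly \<kappa> (Suc m)) \<noteq> 0" "degree (pderiv (appell_poly \<kappa> (Suc m))) = m"
      using Suc by (simp_all add: pderiv_appell_poly del: appell_poly.simps)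
    then show ?case by (auto simp: degree_pderiv pderiv_eq_0_iff simp del: appell_poly.simps)
  qed simp
  then show ?thesis ..
qed

text \<open>The addition formula of Appell sequences, by induction on \<open>m\<close>: as
  polynomials in \<open>g\<close> both sides have the same derivative and the same value at
  \<open>g = 0\<close>.\<close>

lemma poly_appell_poly_add:
  "poly (appell_poly \<kappa> m) (y + g) = (\<Sum>j\<le>m. real (m choose j) * (g ^ j * poly (appell_poly \<kappa> (m - j)) y))"
proof -
  \<comment> \<open>\<open>R m\<close> is the right side as a polynomial in \<open>g\<close> with
    \<open>y\<close> fixed; composition with \<open>[:y, 1:]\<close> gives the left side.\<close>
  define R where "R m = (\<Sum>j\<le>m. monom (real (m choose j) * poly (appell_poly \<kappa> (m - j)) y) j)" for m
  have "pcompose (appell_poly \<kappa> m) [:y, 1:] = R m"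
  proof (induction m)
    case 0
    then show ?case by (simp add: R_def pcompose_1)
  next
    case (Suc m)
    have "pderiv (pcompose (appell_poly \<kappa> (Suc m)) [:y, 1:]) = smult (real (Suc m)) (R m)"
      unfolding pderiv_pcompose pderiv_appell_poly Suc[symmetric]
      by (simp add: pderiv_pCons pcompose_smult)
    also have "\<dots> = pderiv (R (Suc m))"
    proof -
      have "pderiv (R (Suc m)) = (\<Sum>j\<le>Suc m. monom (real j * (real (Suc m choose j) *
          poly (appell_poly \<kappa> (Suc m - j)) y)) (j - 1))"
        by (simp only: R_def pderiv_sum pderiv_monom of_nat_id)
      also have "\<dots> = (\<Sum>j\<le>m. monom (real (Suc j) * (real (Suc m choose Suc j) *
          poly (appell_poly \<kappa> (m - j)) y)) j)"
        by (subst sum.atMost_Suc_shift) simp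
      also have "\<dots> = (\<Sum>j\<le>m. smult (real (Suc m)) (monom (real (m choose j) * poly (appell_poly \<kappa> (m - j)) y) j))"
      proof (intro sum.cong refl)
        fix j
        have "real (Suc j) * real (Suc m choose Suc j) = real (Suc m) * real (m choose j)"
          using Suc_times_binomial[of j m] by (metis of_nat_mult)
        then show "monom (real (Suc j) * (real (Suc m choose Suc j) * poly (appell_poly \<kappa> (m - j)) y)) j =
            smult (real (Suc m)) (monom (real (m choose j) * poly (appell_poly \<kappa> (m - j)) y) j)"
          unfolding smult_monom by (metis mult.assoc)
      qed
      also have "\<dots> = smult (real (Suc m)) (R m)"
        by (simp add: R_def smult_sum_right)
      finally show ?thesis ..
    qed
    finally obtain c where c: "pcompose (appell_poly \<kappa> (Suc m)) [:y, 1:] = R (Suc m) + [:c:]"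
      by (rule pderiv_eq_imp_const)
    have "poly (R (Suc m)) 0 = poly (appell_poly \<kappa> (Suc m)) y"
      unfolding R_def poly_sum poly_monom
      by (subst sum.atMost_Suc_shift) (simp del: appell_poly.simps)
    moreover have "poly (pcompose (appell_poly \<kappa> (Suc m)) [:y, 1:]) 0 = poly (appell_poly \<kappa> (Suc m)) y"
      by (simp add: poly_pcompose del: appell_poly.simps)
    ultimately have "c = 0" using c by simp
    then show ?case using c by simp
  qed
  then have "poly (pcompose (appell_poly \<kappa> m) [:y, 1:]) g = poly (R m) g" by simp
  then show ?thesis by (simp add: poly_pcompose R_def poly_sum poly_monom mult_ac)
qed

subsection \<open>Averages over sign vectors\<close>

definition sign_vectors :: "nat \<Rightarrow> (nat \<Rightarrow> real) set" where
  "sign_vectors n = {1..n} \<rightarrow>\<^sub>E {- 1, 1}"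

text \<open>The expectation under the joint law of the first \<open>n\<close> noise variables,
  written as a finite sum.\<close>

definition sign_avg :: "nat \<Rightarrow> ((nat \<Rightarrow> real) \<Rightarrow> real) \<Rightarrow> real" where
  "sign_avg n F = (\<Sum>\<sigma>\<in>sign_vectors n. F \<sigma>) / 2 ^ n"

lemma finite_sign_vectors: "finite (sign_vectors n)"
  unfolding sign_vectors_def by (intro finite_PiE) auto

lemma card_sign_vectors: "card (sign_vectors n) = 2 ^ n"
  unfolding sign_vectors_def by (subst card_PiE) (auto simp: numeral_2_eq_2)

lemma sign_avg_diff: "sign_avg n (\<lambda>\<sigma>. F \<sigma> - G \<sigma>) = sign_avg n F - sign_avg n G"
  by (simp add: sign_avg_def sum_subtractf diff_divide_distrib)

lemma sign_avg_mult_left: "sign_avg n (\<lambda>\<sigma>. c * F \<sigma>) = c * sign_avg n F"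
  by (simp add: sign_avg_def flip: sum_distrib_left)

lemma sign_avg_sum: "sign_avg n (\<lambda>\<sigma>. \<Sum>i\<in>I. F i \<sigma>) = (\<Sum>i\<in>I. sign_avg n (F i))"
  unfolding sign_avg_def by (subst sum.swap) (simp add: sum_divide_distrib)

lemma sign_avg_const: "sign_avg n (\<lambda>\<sigma>. c) = c"
  by (simp add: sign_avg_def card_sign_vectors)

lemma sign_avg_cong: "(\<And>\<sigma>. \<sigma> \<in> sign_vectors n \<Longrightarrow> F \<sigma> = G \<sigma>) \<Longrightarrow> sign_avg n F = sign_avg n G"
  by (simp add: sign_avg_def)

text \<open>Flipping the sign at \<open>k\<close> permutes the sign vectors, so \<open>F\<close> may
  be averaged with its flip; the resulting pair of values is the same for either sign
  \<open>\<sigma> k\<close>.\<close>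

lemma sign_avg_symmetrize:
  assumes "k \<in> {1..n}"
  shows "sign_avg n F = sign_avg n (\<lambda>\<sigma>. (F (\<sigma>(k := 1)) + F (\<sigma>(k := - 1))) / 2)"
proof -
  have "sign_avg n F = sign_avg n (\<lambda>\<sigma>. F (\<sigma>(k := - \<sigma> k)))"
  proof -
    have "(\<Sum>\<sigma>\<in>sign_vectors n. F \<sigma>) = (\<Sum>\<sigma>\<in>sign_vectors n. F (\<sigma>(k := - \<sigma> k)))"
      by (rule sum.reindex_bij_witness[of _ "\<lambda>\<sigma>. \<sigma>(k := - \<sigma> k)" "\<lambda>\<sigma>. \<sigma>(k := - \<sigma> k)"])
         (use assms in \<open>auto simp: sign_vectors_def PiE_iff extensional_def\<close>)
    then show ?thesis by (simp add: sign_avg_def)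
  qed
  then have "sign_avg n F = (1 / 2) * (sign_avg n F + sign_avg n (\<lambda>\<sigma>. F (\<sigma>(k := - \<sigma> k))))"
    by simp
  also have "\<dots> = sign_avg n (\<lambda>\<sigma>. (F \<sigma> + F (\<sigma>(k := - \<sigma> k))) / 2)"
    by (simp add: sign_avg_def sum.distrib sum_divide_distrib[symmetric] add_divide_distrib)
  also have "\<dots> = sign_avg n (\<lambda>\<sigma>. (F (\<sigma>(k := 1)) + F (\<sigma>(k := - 1))) / 2)"
  proof (rule sign_avg_cong)
    fix \<sigma> assume "\<sigma> \<in> sign_vectors n"
    then have "\<sigma> k = 1 \<or> \<sigma> k = - 1" using assms by (auto simp: sign_vectors_def PiE_iff)
    moreover have "\<sigma>(k := \<sigma> k) = \<sigma>" by simp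
    ultimately show "(F \<sigma> + F (\<sigma>(k := - \<sigma> k))) / 2 = (F (\<sigma>(k := 1)) + F (\<sigma>(k := - 1))) / 2"
      by (metis add.commute minus_minus)
  qed
  finally show ?thesis .
qed

text \<open>A multiplicative form of \<open>sinh = tanh * cosh\<close>.\<close>

lemma tanh_Pow_identity:
  fixes \<Phi> :: "real \<Rightarrow> 'b set \<Rightarrow> real"
  assumes "finite V"
    and \<Phi>: "\<And>e W. W \<subseteq> V \<Longrightarrow> \<Phi> e W = (\<Sum>A\<in>Pow W. e ^ card A * ((\<Prod>v\<in>A. x v) * \<Psi> (W - A)))"
  shows "\<Phi> 1 V - \<Phi> (- 1) V =
    (\<Sum>D\<in>Pow V. tanh_coeff (card D) * ((\<Prod>v\<in>D. x v) * (\<Phi> 1 (V - D) + \<Phi> (- 1) (V - D))))"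
proof -
  have fin: "finite A" if "A \<subseteq> V" for A using that assms(1) by (rule finite_subset)
  have "(\<Sum>D\<in>Pow V. tanh_coeff (card D) * ((\<Prod>v\<in>D. x v) * (\<Phi> 1 (V - D) + \<Phi> (- 1) (V - D)))) =
    (\<Sum>D\<in>Pow V. \<Sum>A\<in>Pow (V - D). tanh_coeff (card D) * (1 + (- 1) ^ card A) *
      ((\<Prod>v\<in>D. x v) * (\<Prod>v\<in>A. x v)) * \<Psi> (V - D - A))"
  proof (intro sum.cong refl)
    fix D
    have "\<Phi> 1 (V - D) + \<Phi> (- 1) (V - D) =
        (\<Sum>A\<in>Pow (V - D). (1 + (- 1) ^ card A) * ((\<Prod>v\<in>A. x v) * \<Psi> (V - D - A)))"
      by (subst (1 2) \<Phi>) (auto simp: sum.distrib[symmetric] distrib_right)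
    then show "tanh_coeff (card D) * ((\<Prod>v\<in>D. x v) * (\<Phi> 1 (V - D) + \<Phi> (- 1) (V - D))) =
      (\<Sum>A\<in>Pow (V - D). tanh_coeff (card D) * (1 + (- 1) ^ card A) *
        ((\<Prod>v\<in>D. x v) * (\<Prod>v\<in>A. x v)) * \<Psi> (V - D - A))"
      by (simp only: sum_distrib_left mult_ac)
  qed
  \<comment> \<open>Collecting by the union \<open>A\<close> of the two subsets makes the product
    over \<open>A\<close> and \<open>\<Psi> (V - A)\<close> common to all \<open>D\<close>.\<close>
  also have "\<dots> = (\<Sum>A\<in>Pow V. \<Sum>D\<in>Pow A. tanh_coeff (card D) * (1 + (- 1) ^ card (A - D)) *
      ((\<Prod>v\<in>D. x v) * (\<Prod>v\<in>A - D. x v)) * \<Psi> (V - D - (A - D)))"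
    using assms(1) by (rule sum_Pow_Pow_Diff)
  also have "\<dots> = (\<Sum>A\<in>Pow V. (1 - (- 1) ^ card A) * ((\<Prod>v\<in>A. x v) * \<Psi> (V - A)))"
  proof (intro sum.cong refl)
    fix A assume "A \<in> Pow V"
    then have A: "A \<subseteq> V" "finite A" using fin by auto
    have "(\<Sum>D\<in>Pow A. tanh_coeff (card D) * (1 + (- 1) ^ card (A - D)) *
        ((\<Prod>v\<in>D. x v) * (\<Prod>v\<in>A - D. x v)) * \<Psi> (V - D - (A - D))) =
      (\<Sum>D\<in>Pow A. tanh_coeff (card D) * (1 + (- 1) ^ (card A - card D)) *
        ((\<Prod>v\<in>A. x v) * \<Psi> (V - A)))"
    proof (intro sum.cong refl)
      fix D assume "D \<in> Pow A"
      then have D: "D \<subseteq> A" "finite D" using A by (auto intro: finite_subset)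
      have "V - D - (A - D) = V - A" using D by auto
      moreover have "(\<Prod>v\<in>D. x v) * (\<Prod>v\<in>A - D. x v) = (\<Prod>v\<in>A. x v)"
        using prod.subset_diff[OF D(1) A(2), of x] by (simp add: mult.commute)
      ultimately show "tanh_coeff (card D) * (1 + (- 1) ^ card (A - D)) *
          ((\<Prod>v\<in>D. x v) * (\<Prod>v\<in>A - D. x v)) * \<Psi> (V - D - (A - D)) =
        tanh_coeff (card D) * (1 + (- 1) ^ (card A - card D)) * ((\<Prod>v\<in>A. x v) * \<Psi> (V - A))"
        using D by (simp add: card_Diff_subset)
    qed
    \<comment> \<open>The remaining sum depends on \<open>D\<close> only through its size and is
      \<open>tanh_coeff_convolution\<close>.\<close>
    also have "\<dots> = (1 - (- 1) ^ card A) * ((\<Prod>v\<in>A. x v) * \<Psi> (V - A))"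
      using sum_Pow_card[OF A(2), of "\<lambda>j. tanh_coeff j * (1 + (- 1) ^ (card A - j))"]
        tanh_coeff_convolution[of "card A"]
      by (simp flip: sum_distrib_right)
    finally show "(\<Sum>D\<in>Pow A. tanh_coeff (card D) * (1 + (- 1) ^ card (A - D)) *
        ((\<Prod>v\<in>D. x v) * (\<Prod>v\<in>A - D. x v)) * \<Psi> (V - D - (A - D))) =
      (1 - (- 1) ^ card A) * ((\<Prod>v\<in>A. x v) * \<Psi> (V - A))" .
  qed
  also have "\<dots> = \<Phi> 1 V - \<Phi> (- 1) V"
    by (subst (1 2) \<Phi>) (auto simp: sum_subtractf[symmetric] left_diff_distrib)
  finally show ?thesis ..
qed

section \<open>Wick products of linear forms in the signs\<close>

definition linear_form :: "nat \<Rightarrow> (nat \<Rightarrow> real) \<Rightarrow> (nat \<Rightarrow> real) \<Rightarrow> real" where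
  "linear_form n g \<sigma> = (\<Sum>k = 1..n. g k * \<sigma> k)"

lemma linear_form_cong: "(\<And>k. k \<in> {1..n} \<Longrightarrow> \<sigma> k = \<tau> k) \<Longrightarrow> linear_form n g \<sigma> = linear_form n g \<tau>"
  by (simp add: linear_form_def)

text \<open>The cumulant of order \<open>j + 1\<close> of the linear form: cumulants of independent
  summands add, and scaling a sign by \<open>g k\<close> multiplies its cumulant by
  \<open>g k ^ Suc j\<close>.\<close>

definition cumulants :: "nat \<Rightarrow> (nat \<Rightarrow> real) \<Rightarrow> nat \<Rightarrow> real" where
  "cumulants n g j = tanh_coeff j * (\<Sum>k = 1..n. g k ^ Suc j)"

text \<open>The product of Wick powers attached to a vertex set \<open>V\<close> whose elements are coloured by
  their factor.\<close>

definition wick_prod ::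
    "nat \<Rightarrow> 'i set \<Rightarrow> ('i \<Rightarrow> nat \<Rightarrow> real) \<Rightarrow> ('b \<Rightarrow> 'i) \<Rightarrow> 'b set \<Rightarrow> (nat \<Rightarrow> real) \<Rightarrow> real" where
  "wick_prod n I g c V \<sigma> =
    (\<Prod>i\<in>I. poly (appell_poly (cumulants n (g i)) (card {v \<in> V. c v = i})) (linear_form n (g i) \<sigma>))"

text \<open>For nonempty \<open>B\<close>, the joint cumulant of the linear forms attached to its
  elements; the \<open>- 1\<close> is there because \<open>tanh_coeff j\<close> belongs to order
  \<open>j + 1\<close>.\<close>

definition joint_cumulant :: "nat \<Rightarrow> ('i \<Rightarrow> nat \<Rightarrow> real) \<Rightarrow> ('b \<Rightarrow> 'i) \<Rightarrow> 'b set \<Rightarrow> real" where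
  "joint_cumulant n g c B = tanh_coeff (card B - 1) * (\<Sum>k = 1..n. \<Prod>v\<in>B. g (c v) k)"

text \<open>With the other signs fixed, averaging over the sign at \<open>k\<close> leaves half the
  difference of the Wick products at \<open>1\<close> and \<open>- 1\<close>. By
  \<open>tanh_Pow_identity\<close> this becomes a combination of half-sums for smaller vertex sets,
  and each half-sum averages back to a \<open>sign_avg\<close>.\<close>

lemma sign_avg_mult_wick_prod:
  assumes "finite V" "finite I" "c ` V \<subseteq> I" "k \<in> {1..n}"
  shows "sign_avg n (\<lambda>\<sigma>. \<sigma> k * wick_prod n I g c V \<sigma>) =
    (\<Sum>D\<in>Pow V. tanh_coeff (card D) * (\<Prod>v\<in>D. g (c v) k) * sign_avg n (wick_prod n I g c (V - D)))"
proof -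
  let ?P = "\<lambda>i. appell_poly (cumulants n (g i))"
  \<comment> \<open>\<open>y \<sigma> i\<close> is the linear form without the sign at
    \<open>k\<close>; setting this sign to \<open>e\<close> shifts the argument by
    \<open>g i k * e\<close>, which is where the Appell addition formula enters.\<close>
  define y where "y \<sigma> i = (\<Sum>j\<in>{1..n} - {k}. g i j * \<sigma> j)" for i \<sigma>
  define \<Psi> where "\<Psi> \<sigma> W = (\<Prod>i\<in>I. poly (?P i (card {v \<in> W. c v = i})) (y \<sigma> i))" for W \<sigma>
  define \<Phi> where "\<Phi> \<sigma> e W = wick_prod n I g c W (\<sigma>(k := e))" for \<sigma> e W
  have lin: "linear_form n (g i) (\<sigma>(k := e)) = y \<sigma> i + g i k * e" for i \<sigma> e
  proof -
    have "(\<Sum>j\<in>{1..n} - {k}. g i j * (\<sigma>(k := e)) j) = y \<sigma> i"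
      unfolding y_def by (intro sum.cong) auto
    then show ?thesis
      unfolding linear_form_def using assms(4) by (subst sum.remove[of _ k]) auto
  qed
  have \<Phi>: "\<Phi> \<sigma> e W = (\<Sum>A\<in>Pow W. e ^ card A * ((\<Prod>v\<in>A. g (c v) k) * \<Psi> \<sigma> (W - A)))"
    if "W \<subseteq> V" for \<sigma> e W
  proof -
    have W: "finite W" "{v \<in> W. c v \<in> I} = W" using that assms by (auto intro: finite_subset)
    have "\<Phi> \<sigma> e W = (\<Prod>i\<in>I. \<Sum>A\<in>Pow {v \<in> W. c v = i}.
        (g i k * e) ^ card A * poly (?P i (card {v \<in> W. c v = i} - card A)) (y \<sigma> i))"
      unfolding \<Phi>_def wick_prod_def lin poly_appell_poly_add
      using W by (subst sum_Pow_card) auto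
    \<comment> \<open>The subsets chosen separately in the factors merge into one subset
      \<open>A\<close> of \<open>W\<close>.\<close>
    also have "\<dots> = (\<Sum>A\<in>Pow W. \<Prod>i\<in>I. (g i k * e) ^ card {v \<in> A. c v = i} *
        poly (?P i (card {v \<in> W. c v = i} - card {v \<in> A. c v = i})) (y \<sigma> i))"
      using prod_sum_Pow_fibres[OF assms(2), of "\<lambda>i A. (g i k * e) ^ card A *
        poly (?P i (card {v \<in> W. c v = i} - card A)) (y \<sigma> i)" W c] unfolding W(2) .
    also have "\<dots> = (\<Sum>A\<in>Pow W. e ^ card A * ((\<Prod>v\<in>A. g (c v) k) * \<Psi> \<sigma> (W - A)))"
    proof (intro sum.cong refl)
      fix A assume "A \<in> Pow W"
      then have A: "A \<subseteq> W" "finite A" "c ` A \<subseteq> I"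
        using W that assms(3) by (auto intro: finite_subset)
      have "e ^ card A * (\<Prod>v\<in>A. g (c v) k) = (\<Prod>v\<in>A. g (c v) k * e)"
        by (simp add: prod.distrib)
      also have "\<dots> = (\<Prod>i\<in>I. \<Prod>v\<in>{v \<in> A. c v = i}. g (c v) k * e)"
        using A assms by (intro prod.group[symmetric]) auto
      also have "\<dots> = (\<Prod>i\<in>I. (g i k * e) ^ card {v \<in> A. c v = i})"
        by (intro prod.cong) auto
      finally have 1: "e ^ card A * (\<Prod>v\<in>A. g (c v) k) = \<dots>" .
      have "card {v \<in> W. c v = i} - card {v \<in> A. c v = i} = card {v \<in> W - A. c v = i}" for i
      proof -
        have "{v \<in> W - A. c v = i} = {v \<in> W. c v = i} - {v \<in> A. c v = i}" by auto
        then show ?thesis using A by (subst card_Diff_subset[symmetric]) auto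
      qed
      then show "(\<Prod>i\<in>I. (g i k * e) ^ card {v \<in> A. c v = i} *
          poly (?P i (card {v \<in> W. c v = i} - card {v \<in> A. c v = i})) (y \<sigma> i)) =
        e ^ card A * ((\<Prod>v\<in>A. g (c v) k) * \<Psi> \<sigma> (W - A))"
        using 1 by (simp add: prod.distrib \<Psi>_def flip: mult.assoc)
    qed
    finally show ?thesis .
  qed
  have "sign_avg n (\<lambda>\<sigma>. \<sigma> k * wick_prod n I g c V \<sigma>) = sign_avg n (\<lambda>\<sigma>. (\<Phi> \<sigma> 1 V - \<Phi> \<sigma> (- 1) V) / 2)"
    by (subst sign_avg_symmetrize[OF assms(4)]) (simp add: \<Phi>_def)
  also have "\<dots> = sign_avg n (\<lambda>\<sigma>. \<Sum>D\<in>Pow V. tanh_coeff (card D) * (\<Prod>v\<in>D. g (c v) k) *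
      ((\<Phi> \<sigma> 1 (V - D) + \<Phi> \<sigma> (- 1) (V - D)) / 2))"
    by (subst tanh_Pow_identity[OF assms(1) \<Phi>]) (simp_all add: sum_divide_distrib mult.assoc)
  also have "\<dots> = (\<Sum>D\<in>Pow V. tanh_coeff (card D) * (\<Prod>v\<in>D. g (c v) k) *
      sign_avg n (\<lambda>\<sigma>. (\<Phi> \<sigma> 1 (V - D) + \<Phi> \<sigma> (- 1) (V - D)) / 2))"
    by (simp only: sign_avg_sum sign_avg_mult_left)
  also have "\<dots> = (\<Sum>D\<in>Pow V. tanh_coeff (card D) * (\<Prod>v\<in>D. g (c v) k) *
      sign_avg n (wick_prod n I g c (V - D)))"
    unfolding \<Phi>_def sign_avg_symmetrize[OF assms(4), symmetric] ..
  finally show ?thesis .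
qed

text \<open>Only the factor of colour \<open>c v\<close> changes. Its polynomial recursion, with
  binomial coefficients read as numbers of subsets, gives the sum over sets \<open>D\<close> of
  other vertices of that colour.\<close>

lemma wick_prod_insert:
  assumes "finite V" "finite I" "v \<notin> V" "c v \<in> I"
  shows "wick_prod n I g c (insert v V) \<sigma> = linear_form n (g (c v)) \<sigma> * wick_prod n I g c V \<sigma> -
    (\<Sum>D\<in>Pow {w \<in> V. c w = c v}. cumulants n (g (c v)) (card D) * wick_prod n I g c (V - D) \<sigma>)"
proof -
  let ?P = "\<lambda>i. appell_poly (cumulants n (g i))" and ?x = "\<lambda>i. linear_form n (g i) \<sigma>"
  define i where "i = c v"
  define V' where "V' = {w \<in> V. c w = i}"
  define rest where "rest = (\<Prod>j\<in>I - {i}. poly (?P j (card {w \<in> V. c w = j})) (?x j))"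
  have i: "i \<in> I" using assms by (simp add: i_def)
  \<comment> \<open>One formula serves all sets that agree with \<open>V\<close> outside colour
    \<open>i\<close>: the remaining factors always multiply to \<open>rest\<close>.\<close>
  have split: "wick_prod n I g c W \<sigma> = poly (?P i (card {w \<in> W. c w = i})) (?x i) * rest"
    if "\<And>w. c w \<noteq> i \<Longrightarrow> w \<in> W \<longleftrightarrow> w \<in> V" for W
  proof -
    have "{w \<in> W. c w = j} = {w \<in> V. c w = j}" if "j \<noteq> i" for j
      using \<open>\<And>w. c w \<noteq> i \<Longrightarrow> w \<in> W \<longleftrightarrow> w \<in> V\<close> that by auto
    then show ?thesis
      unfolding wick_prod_def rest_def prod.remove[OF assms(2) i]
      by (intro arg_cong2[of _ _ _ _ "(*)"] prod.cong) auto
  qed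
  have fV': "finite V'" using assms by (simp add: V'_def)
  have "{w \<in> insert v V. c w = i} = insert v V'" by (auto simp: V'_def i_def)
  moreover have "card (insert v V') = Suc (card V')" using assms fV' by (simp add: V'_def)
  ultimately have "wick_prod n I g c (insert v V) \<sigma> = poly (?P i (Suc (card V'))) (?x i) * rest"
    by (subst split) (auto simp: i_def)
  also have "\<dots> = ?x i * (poly (?P i (card V')) (?x i) * rest) -
      (\<Sum>j\<le>card V'. real (card V' choose j) *
        (cumulants n (g i) j * poly (?P i (card V' - j)) (?x i))) * rest"
    by (simp add: poly_sum left_diff_distrib mult.assoc)
  also have "(\<Sum>j\<le>card V'. real (card V' choose j) *
        (cumulants n (g i) j * poly (?P i (card V' - j)) (?x i))) =
      (\<Sum>D\<in>Pow V'. cumulants n (g i) (card D) * poly (?P i (card V' - card D)) (?x i))"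
    using sum_Pow_card[OF fV', of "\<lambda>j. cumulants n (g i) j * poly (?P i (card V' - j)) (?x i)"] by simp
  also have "\<dots> * rest = (\<Sum>D\<in>Pow V'. cumulants n (g i) (card D) * wick_prod n I g c (V - D) \<sigma>)"
    unfolding sum_distrib_right
  proof (intro sum.cong refl)
    fix D assume "D \<in> Pow V'"
    then have D: "D \<subseteq> V'" "finite D" using fV' by (auto intro: finite_subset)
    have "{w \<in> V - D. c w = i} = V' - D" by (auto simp: V'_def)
    then have "card V' - card D = card {w \<in> V - D. c w = i}" using D by (simp add: card_Diff_subset)
    then show "cumulants n (g i) (card D) * poly (?P i (card V' - card D)) (?x i) * rest =
        cumulants n (g i) (card D) * wick_prod n I g c (V - D) \<sigma>"
      using D by (subst split) (auto simp: V'_def)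
  qed
  also have "poly (?P i (card V')) (?x i) * rest = wick_prod n I g c V \<sigma>"
    by (subst split) (auto simp: V'_def)
  finally show ?thesis unfolding V'_def i_def .
qed

text \<open>Multiplication by the linear form of \<open>v\<close> yields all \<open>D\<close>, by
  \<open>sign_avg_mult_wick_prod\<close>; the terms subtracted in \<open>wick_prod_insert\<close>
  are precisely those with \<open>D\<close> inside the colour of \<open>v\<close>, so only sets
  meeting another colour survive.\<close>

lemma sign_avg_wick_prod_insert:
  assumes "finite V" "finite I" "v \<notin> V" "c ` insert v V \<subseteq> I"
  shows "sign_avg n (wick_prod n I g c (insert v V)) =
    (\<Sum>D\<in>Pow V. (if c ` insert v D = {c v} then 0 else joint_cumulant n g c (insert v D)) *
      sign_avg n (wick_prod n I g c (V - D)))"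
proof -
  let ?J = "\<lambda>D. joint_cumulant n g c (insert v D)" and ?E = "\<lambda>W. sign_avg n (wick_prod n I g c W)"
  let ?V' = "{w \<in> V. c w = c v}"
  have fin: "finite D" if "D \<subseteq> V" for D using that assms(1) by (rule finite_subset)
  have J: "?J D = tanh_coeff (card D) * (\<Sum>k = 1..n. g (c v) k * (\<Prod>w\<in>D. g (c w) k))"
    if "D \<subseteq> V" for D
  proof -
    have "v \<notin> D" using that assms by auto
    then show ?thesis using fin[OF that] by (simp add: joint_cumulant_def)
  qed
  have 1: "sign_avg n (\<lambda>\<sigma>. linear_form n (g (c v)) \<sigma> * wick_prod n I g c V \<sigma>) =
      (\<Sum>D\<in>Pow V. ?J D * ?E (V - D))"
  proof -
    have "sign_avg n (\<lambda>\<sigma>. linear_form n (g (c v)) \<sigma> * wick_prod n I g c V \<sigma>) =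
      (\<Sum>k = 1..n. g (c v) k * sign_avg n (\<lambda>\<sigma>. \<sigma> k * wick_prod n I g c V \<sigma>))"
      unfolding linear_form_def sum_distrib_right by (simp add: sign_avg_sum sign_avg_mult_left mult.assoc)
    also have "\<dots> = (\<Sum>k = 1..n. \<Sum>D\<in>Pow V. g (c v) k * (tanh_coeff (card D) *
        (\<Prod>w\<in>D. g (c w) k) * ?E (V - D)))"
      using assms by (simp add: sign_avg_mult_wick_prod sum_distrib_left)
    also have "\<dots> = (\<Sum>D\<in>Pow V. ?J D * ?E (V - D))"
      by (subst sum.swap) (auto intro!: sum.cong simp: J sum_distrib_left sum_distrib_right mult_ac)
    finally show ?thesis .
  qed
  \<comment> \<open>On a single colour the joint cumulant is the cumulant of one linear
    form.\<close>
  have 2: "cumulants n (g (c v)) (card D) = ?J D" if "D \<subseteq> ?V'" for D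
  proof -
    have "(\<Prod>w\<in>D. g (c w) k) = g (c v) k ^ card D" for k
      using that by (simp add: subset_eq)
    then show ?thesis using that by (subst J) (auto simp: cumulants_def)
  qed
  have "?E (insert v V) = (\<Sum>D\<in>Pow V. ?J D * ?E (V - D)) - (\<Sum>D\<in>Pow ?V'. ?J D * ?E (V - D))"
  proof -
    have "?E (insert v V) = sign_avg n (\<lambda>\<sigma>. linear_form n (g (c v)) \<sigma> * wick_prod n I g c V \<sigma>) -
      sign_avg n (\<lambda>\<sigma>. \<Sum>D\<in>Pow ?V'. cumulants n (g (c v)) (card D) * wick_prod n I g c (V - D) \<sigma>)"
      unfolding sign_avg_diff[symmetric]
      using assms by (intro sign_avg_cong wick_prod_insert) auto
    also have "sign_avg n (\<lambda>\<sigma>. \<Sum>D\<in>Pow ?V'. cumulants n (g (c v)) (card D) * wick_prod n I g c (V - D) \<sigma>) =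
        (\<Sum>D\<in>Pow ?V'. ?J D * ?E (V - D))"
      unfolding sign_avg_sum sign_avg_mult_left using 2 by (intro sum.cong) auto
    finally show ?thesis unfolding 1 .
  qed
  also have "\<dots> = (\<Sum>D\<in>Pow V - Pow ?V'. ?J D * ?E (V - D))"
    using assms(1) by (intro sum_diff[symmetric]) auto
  also have "\<dots> = (\<Sum>D\<in>Pow V. (if c ` insert v D = {c v} then 0 else ?J D) * ?E (V - D))"
    using assms(1) by (intro sum.mono_neutral_cong_left) auto
  finally show ?thesis .
qed

lemma sign_avg_wick_prod:
  assumes "finite V" "finite I" "c ` V \<subseteq> I"
  shows "sign_avg n (wick_prod n I g c V) =
    (\<Sum>S | partition_on V S. \<Prod>s\<in>S. if \<exists>i. c ` s = {i} then 0 else joint_cumulant n g c s)"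
proof (rule partition_expansion[OF assms(1)])
  show "sign_avg n (wick_prod n I g c {}) = 1"
    by (simp add: wick_prod_def[abs_def] sign_avg_const)
next
  fix v W assume W: "insert v W \<subseteq> V" "v \<notin> W"
  \<comment> \<open>The only colour that \<open>insert v D\<close> can have alone is that of
    \<open>v\<close>, which matches the block weight with the weight in the recursion.\<close>
  have *: "(\<exists>i. c ` insert v D = {i}) \<longleftrightarrow> c ` insert v D = {c v}" for D by auto
  show "sign_avg n (wick_prod n I g c (insert v W)) =
    (\<Sum>D\<in>Pow W. (if \<exists>i. c ` insert v D = {i} then 0 else joint_cumulant n g c (insert v D)) *
      sign_avg n (wick_prod n I g c (W - D)))"
    unfolding * using W assms
    by (intro sign_avg_wick_prod_insert) (auto intro: finite_subset)
qed

text \<open>With a single colour every weight in the recursion is 0; \<open>m \<ge> 1\<close>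
  supplies a vertex to insert.\<close>

lemma sign_avg_appell_poly:
  assumes "m \<ge> 1"
  shows "sign_avg n (\<lambda>\<sigma>. poly (appell_poly (cumulants n h) m) (linear_form n h \<sigma>)) = 0"
proof -
  define c :: "nat \<Rightarrow> unit" where "c = (\<lambda>_. ())"
  obtain k where m: "m = Suc k" using assms by (cases m) auto
  have "sign_avg n (wick_prod n {()} (\<lambda>_. h) c (insert k {..<k})) = 0"
    by (subst sign_avg_wick_prod_insert) (auto simp: c_def intro!: sum.neutral)
  moreover have "insert k {..<k} = {..<m}" using m by auto
  ultimately show ?thesis by (simp add: wick_prod_def[abs_def] c_def)
qed

subsection \<open>Expectations of functions of the noise\<close>

lemma measurable_poly: "X \<in> borel_measurable M \<Longrightarrow> (\<lambda>\<omega>. poly p (X \<omega>)) \<in> borel_measurable M"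
  for p :: "real poly"
  unfolding poly_altdef by measurable

context bernoulli_noise
begin

lemma measurable_noise [measurable]: "k \<ge> 1 \<Longrightarrow> \<epsilon> k \<in> borel_measurable M"
  using indep by (auto simp: indep_vars_def)

lemma AE_noise_sign:
  assumes "k \<ge> 1"
  shows "AE \<omega> in M. \<epsilon> k \<omega> \<in> {- 1, 1}"
proof -
  note measurable_noise[OF assms, measurable]
  have "prob {\<omega> \<in> space M. \<epsilon> k \<omega> \<in> {- 1, 1}} =
    prob ({\<omega> \<in> space M. \<epsilon> k \<omega> = 1} \<union> {\<omega> \<in> space M. \<epsilon> k \<omega> = - 1})"
    by (intro arg_cong[of _ _ prob]) auto
  also have "\<dots> = 1"
    using prob_pos[OF assms] prob_neg[OF assms] by (subst finite_measure_Union) auto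
  finally show ?thesis
    by (rule AE_mp[OF AE_prob_1]) auto
qed

lemma prob_noise_eq:
  assumes "n \<ge> 1" "\<sigma> \<in> sign_vectors n"
  shows "prob {\<omega> \<in> space M. \<forall>k\<in>{1..n}. \<epsilon> k \<omega> = \<sigma> k} = 1 / 2 ^ n"
proof -
  have "{\<omega> \<in> space M. \<forall>k\<in>{1..n}. \<epsilon> k \<omega> = \<sigma> k} = (\<Inter>k\<in>{1..n}. \<epsilon> k -` {\<sigma> k} \<inter> space M)"
    using assms by auto
  also have "prob \<dots> = (\<Prod>k\<in>{1..n}. prob (\<epsilon> k -` {\<sigma> k} \<inter> space M))"
    using assms by (intro indep_varsD[OF indep]) auto
  also have "\<dots> = (\<Prod>k\<in>{1..n}. 1 / 2)"
  proof (intro prod.cong refl)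
    fix k assume k: "k \<in> {1..n}"
    then have "\<sigma> k = 1 \<or> \<sigma> k = - 1" using assms by (auto simp: sign_vectors_def PiE_iff)
    moreover have "\<epsilon> k -` {\<sigma> k} \<inter> space M = {\<omega> \<in> space M. \<epsilon> k \<omega> = \<sigma> k}" by auto
    ultimately show "prob (\<epsilon> k -` {\<sigma> k} \<inter> space M) = 1 / 2"
      using prob_pos[of k] prob_neg[of k] k by auto
  qed
  finally show ?thesis by (simp add: power_one_over)
qed

text \<open>Almost surely the first \<open>n\<close> noise variables are signs, and then exactly one
  event \<open>A \<sigma>\<close> occurs, so \<open>F\<close> of the noise equals the simple
  function \<open>G\<close>. As sign vectors are extensional, \<open>local\<close> serves to replace
  the noise by its restriction to \<open>{1..n}\<close>.\<close>

lemma expectation_noise: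
  assumes "n \<ge> 1"
    and local: "\<And>\<sigma> \<tau>. (\<And>k. k \<in> {1..n} \<Longrightarrow> \<sigma> k = \<tau> k) \<Longrightarrow> F \<sigma> = F \<tau>"
    and meas [measurable]: "(\<lambda>\<omega>. F (\<lambda>k. \<epsilon> k \<omega>)) \<in> borel_measurable M"
  shows "integrable M (\<lambda>\<omega>. F (\<lambda>k. \<epsilon> k \<omega>))"
    and "(LINT \<omega>|M. F (\<lambda>k. \<epsilon> k \<omega>)) = sign_avg n F"
proof -
  define A where "A \<sigma> = {\<omega> \<in> space M. \<forall>k\<in>{1..n}. \<epsilon> k \<omega> = \<sigma> k}" for \<sigma> :: "nat \<Rightarrow> real"
  have [measurable]: "A \<sigma> \<in> sets M" for \<sigma>
    unfolding A_def by measurable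
  define G where "G \<omega> = (\<Sum>\<sigma>\<in>sign_vectors n. F \<sigma> * indicator (A \<sigma>) \<omega>)" for \<omega>
  have intG: "integrable M G"
    unfolding G_def by (intro Bochner_Integration.integrable_sum integrable_mult_right) (simp add: emeasure_eq_measure)
  have "AE \<omega> in M. \<forall>k\<in>{1..n}. \<epsilon> k \<omega> \<in> {- 1, 1}"
    by (intro AE_finite_allI) (auto intro!: AE_noise_sign simp del: insert_iff)
  then have eq: "AE \<omega> in M. F (\<lambda>k. \<epsilon> k \<omega>) = G \<omega>"
  proof (rule AE_mp, intro AE_I2 impI)
    fix \<omega> assume \<omega>: "\<omega> \<in> space M" and signs: "\<forall>k\<in>{1..n}. \<epsilon> k \<omega> \<in> {- 1, 1}"
    define \<tau> where "\<tau> = restrict (\<lambda>k. \<epsilon> k \<omega>) {1..n}"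
    have \<tau>: "\<tau> \<in> sign_vectors n"
      using signs by (auto simp: sign_vectors_def \<tau>_def)
    have "indicator (A \<sigma>) \<omega> = (if \<sigma> = \<tau> then 1 else 0 :: real)" if "\<sigma> \<in> sign_vectors n" for \<sigma>
    proof -
      have "(\<forall>k\<in>{1..n}. \<epsilon> k \<omega> = \<sigma> k) \<longleftrightarrow> \<sigma> = \<tau>"
      proof
        assume "\<forall>k\<in>{1..n}. \<epsilon> k \<omega> = \<sigma> k"
        then show "\<sigma> = \<tau>"
          by (intro PiE_ext[OF that[unfolded sign_vectors_def] \<tau>[unfolded sign_vectors_def]])
             (simp add: \<tau>_def)
      qed (simp add: \<tau>_def)
      then show ?thesis using \<omega> by (auto simp: A_def indicator_def)
    qed
    then have "G \<omega> = (\<Sum>\<sigma>\<in>sign_vectors n. if \<sigma> = \<tau> then F \<sigma> else 0)"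
      unfolding G_def by (intro sum.cong) auto
    also have "\<dots> = F \<tau>" using \<tau> by (simp add: finite_sign_vectors)
    also have "\<dots> = F (\<lambda>k. \<epsilon> k \<omega>)" by (rule local) (simp add: \<tau>_def)
    finally show "F (\<lambda>k. \<epsilon> k \<omega>) = G \<omega>" ..
  qed
  have [measurable]: "G \<in> borel_measurable M" using intG by auto
  show "integrable M (\<lambda>\<omega>. F (\<lambda>k. \<epsilon> k \<omega>))"
    using intG eq by (subst integrable_cong_AE[where g = G]) auto
  have "(LINT \<omega>|M. F (\<lambda>k. \<epsilon> k \<omega>)) = (LINT \<omega>|M. G \<omega>)"
    using eq by (intro integral_cong_AE) auto
  also have "\<dots> = (\<Sum>\<sigma>\<in>sign_vectors n. F \<sigma> * prob (A \<sigma>))"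
    unfolding G_def by (subst Bochner_Integration.integral_sum) (auto simp: emeasure_eq_measure)
  also have "\<dots> = sign_avg n F"
    using prob_noise_eq[OF assms(1), folded A_def] by (simp add: sign_avg_def sum_divide_distrib)
  finally show "(LINT \<omega>|M. F (\<lambda>k. \<epsilon> k \<omega>)) = sign_avg n F" .
qed

lemma noise_field_eq_linear_form:
  "noise_field \<epsilon> n h \<omega> = linear_form n (\<lambda>k. h (real k / real n) * (1 / sqrt (real n))) (\<lambda>k. \<epsilon> k \<omega>)"
  by (simp add: noise_field_def linear_form_def)

lemma measurable_linear_form [measurable]: "(\<lambda>\<omega>. linear_form n g (\<lambda>k. \<epsilon> k \<omega>)) \<in> borel_measurable M"
  unfolding linear_form_def by (intro borel_measurable_sum borel_measurable_times) auto

text \<open>By uniqueness of the Wick system: the Appell polynomials have the right degrees and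
  derivatives, and mean zero by \<open>sign_avg_appell_poly\<close>.\<close>

lemma wick_poly_noise_field:
  fixes n :: nat
  assumes "n \<ge> 1"
  defines "g \<equiv> \<lambda>h k. h (real k / real n) * (1 / sqrt (real n))"
  shows "wick_poly M (noise_field \<epsilon> n h) = appell_poly (cumulants n (g h))"
proof -
  let ?\<eta> = "noise_field \<epsilon> n h"
  have \<eta>: "?\<eta> = (\<lambda>\<omega>. linear_form n (g h) (\<lambda>k. \<epsilon> k \<omega>))"
    by (simp add: fun_eq_iff noise_field_eq_linear_form g_def)
  have moments: "integrable M (\<lambda>\<omega>. ?\<eta> \<omega> ^ k)" for k :: nat
    unfolding \<eta> by (intro expectation_noise(1)[OF assms(1)] arg_cong[of _ _ "\<lambda>x. x ^ k"] linear_form_cong) auto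
  have "(LINT \<omega>|M. poly (appell_poly (cumulants n (g h)) m) (?\<eta> \<omega>)) = 0" if "m \<ge> 1" for m
  proof -
    have "(LINT \<omega>|M. poly (appell_poly (cumulants n (g h)) m) (?\<eta> \<omega>)) =
      sign_avg n (\<lambda>\<sigma>. poly (appell_poly (cumulants n (g h)) m) (linear_form n (g h) \<sigma>))"
      unfolding \<eta>
      by (intro expectation_noise(2)[OF assms(1)] arg_cong[of _ _ "poly _"] linear_form_cong)
         (auto intro!: measurable_poly)
    then show ?thesis using sign_avg_appell_poly[OF that] by simp
  qed
  moreover have "pderiv (appell_poly (cumulants n (g h)) m) =
      smult (real m) (appell_poly (cumulants n (g h)) (m - 1))" if "m \<ge> 1" for m
    using pderiv_appell_poly[of _ "m - 1"] that by simp
  ultimately have "wick_system M ?\<eta> (appell_poly (cumulants n (g h)))"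
    by (simp add: wick_system_def degree_appell_poly)
  then show ?thesis
    using ex1_wick_system[OF moments] wick_system_wick_poly[OF moments] by blast
qed

lemma expectation_prod_wick_power:
  fixes I :: "'i set" and c :: "'b \<Rightarrow> 'i" and f :: "'i \<Rightarrow> real \<Rightarrow> real" and n :: nat
  assumes "n \<ge> 1" "finite V" "finite I" "c ` V \<subseteq> I"
  defines "g \<equiv> \<lambda>i k. f i (real k / real n) * (1 / sqrt (real n))"
  shows "(LINT \<omega>|M. (\<Prod>i\<in>I. wick_power M (noise_field \<epsilon> n (f i)) (card {v \<in> V. c v = i}) \<omega>)) =
    (\<Sum>S | partition_on V S. \<Prod>s\<in>S. if \<exists>i. c ` s = {i} then 0 else joint_cumulant n g c s)"
proof -
  have "(LINT \<omega>|M. (\<Prod>i\<in>I. wick_power M (noise_field \<epsilon> n (f i)) (card {v \<in> V. c v = i}) \<omega>)) =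
    (LINT \<omega>|M. wick_prod n I g c V (\<lambda>k. \<epsilon> k \<omega>))"
    by (simp add: wick_power_def wick_poly_noise_field[OF assms(1)] wick_prod_def g_def
      noise_field_eq_linear_form)
  also have "\<dots> = sign_avg n (wick_prod n I g c V)"
  proof (rule expectation_noise(2)[OF assms(1)])
    show "wick_prod n I g c V \<sigma> = wick_prod n I g c V \<tau>"
      if "\<And>k. k \<in> {1..n} \<Longrightarrow> \<sigma> k = \<tau> k" for \<sigma> \<tau>
      unfolding wick_prod_def using linear_form_cong[of n \<sigma> \<tau>] that by simp
    show "(\<lambda>\<omega>. wick_prod n I g c V (\<lambda>k. \<epsilon> k \<omega>)) \<in> borel_measurable M"
      unfolding wick_prod_def by (intro borel_measurable_prod measurable_poly measurable_linear_form)
  qed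
  also have "\<dots> = (\<Sum>S | partition_on V S. \<Prod>s\<in>S. if \<exists>i. c ` s = {i} then 0 else joint_cumulant n g c s)"
    using assms by (intro sign_avg_wick_prod)
  finally show ?thesis .
qed

end

section \<open>Summation over diagrams\<close>

lemma sum_diagram_value:
  fixes f :: "nat \<Rightarrow> real \<Rightarrow> real" and n :: nat
  assumes \<psi>: "bij_betw \<psi> (vertices N d) {1..(\<Sum>i = 1..N. d i)}"
  defines "c \<equiv> fst \<circ> inv_into (vertices N d) \<psi>"
    and "g \<equiv> \<lambda>i k. f i (real k / real n) * (1 / sqrt (real n))"
  shows "(\<Sum>G\<in>diagrams N d \<psi>. diagram_value n N d f \<psi> G) =
    (\<Sum>S\<in>diagram_partitions N d \<psi>. \<Prod>s\<in>S. joint_cumulant n g c s)"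
proof -
  define V where "V = {1..(\<Sum>i = 1..N. d i)}"
  let ?B = "\<lambda>s. \<Sum>k = 1..n. \<Prod>v\<in>{v \<in> vertices N d. \<psi> v \<in> s}. f (fst v) (real k / real n) * (1 / sqrt (real n))"
  have fin_ord: "finite (block_orderings s)" if "finite s" for s
    by (rule finite_subset[of _ "permutations_of_set s"]) (auto simp: block_orderings_def)
  have part: "partition_on V S" "finite S" "\<And>s. s \<in> S \<Longrightarrow> s \<subseteq> V" "\<And>s. s \<in> S \<Longrightarrow> finite s"
    if "S \<in> diagram_partitions N d \<psi>" for S
  proof -
    show S: "partition_on V S" using that by (simp add: diagram_partitions_def V_def)
    then show "finite S" by (intro finite_elements[of V]) (auto simp: V_def)
    show "s \<subseteq> V" if "s \<in> S" for s using that partition_onD1[OF S] by auto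
    show "finite s" if "s \<in> S" for s
      by (rule finite_subset[of s V]) (use \<open>\<And>s. s \<in> S \<Longrightarrow> s \<subseteq> V\<close> that in \<open>auto simp: V_def\<close>)
  qed
  have "finite (diagram_partitions N d \<psi>)"
    by (rule finite_subset[of _ "{S. partition_on V S}"], use part(1) in blast)
       (rule finitely_many_partition_on, simp add: V_def)
  then have "(\<Sum>G\<in>diagrams N d \<psi>. diagram_value n N d f \<psi> G) =
    (\<Sum>S\<in>diagram_partitions N d \<psi>. \<Sum>a\<in>Pi\<^sub>E S block_orderings. diagram_value n N d f \<psi> (S, a))"
    unfolding diagrams_def
    by (subst sum.Sigma) (auto intro!: finite_PiE part fin_ord)
  also have "\<dots> = (\<Sum>S\<in>diagram_partitions N d \<psi>. \<Prod>s\<in>S. joint_cumulant n g c s)"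
  proof (intro sum.cong refl)
    fix S assume S: "S \<in> diagram_partitions N d \<psi>"
    \<comment> \<open>For fixed \<open>S\<close> the orderings of different blocks are chosen
      independently, so the sum over choice functions factors over the blocks.\<close>
    have "(\<Sum>a\<in>Pi\<^sub>E S block_orderings. diagram_value n N d f \<psi> (S, a)) =
      (\<Prod>s\<in>S. \<Sum>a\<in>block_orderings s. (- 1) ^ (ascents a - 1) * ?B s)"
      unfolding diagram_value_def prod.case
      using part[OF S] fin_ord by (intro prod_sum_PiE[symmetric]) auto
    also have "\<dots> = (\<Prod>s\<in>S. joint_cumulant n g c s)"
    proof (intro prod.cong refl)
      fix s assume s: "s \<in> S"
      have "?B s = (\<Sum>k = 1..n. \<Prod>v\<in>s. g (c v) k)"
      proof (intro sum.cong refl)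
        fix k
        \<comment> \<open>The numbering carries the product over vertices to a product over their
          numbers.\<close>
        have "bij_betw \<psi> {v \<in> vertices N d. \<psi> v \<in> s} s"
          using \<psi> part(3)[OF S s] by (auto simp: bij_betw_def V_def inj_on_def subset_eq image_iff)
        then have "(\<Prod>v\<in>s. g (c v) k) = (\<Prod>v\<in>{v \<in> vertices N d. \<psi> v \<in> s}. g (c (\<psi> v)) k)"
          by (rule prod.reindex_bij_betw[symmetric])
        also have "\<dots> = (\<Prod>v\<in>{v \<in> vertices N d. \<psi> v \<in> s}. f (fst v) (real k / real n) * (1 / sqrt (real n)))"
          using \<psi> by (intro prod.cong) (auto simp: g_def c_def bij_betw_def)
        finally show "(\<Prod>v\<in>{v \<in> vertices N d. \<psi> v \<in> s}. f (fst v) (real k / real n) * (1 / sqrt (real n))) =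
          (\<Prod>v\<in>s. g (c v) k)" ..
      qed
      moreover have "s \<noteq> {}" "even (card s)"
        using S s partition_onD3[OF part(1)[OF S]] by (auto simp: diagram_partitions_def)
      \<comment> \<open>The vertex sum does not depend on the ordering, so only the signs are
        summed.\<close>
      ultimately show "(\<Sum>a\<in>block_orderings s. (- 1) ^ (ascents a - 1) * ?B s) = joint_cumulant n g c s"
        using sum_block_orderings[OF part(4)[OF S s]]
        by (simp add: joint_cumulant_def flip: sum_distrib_right)
    qed
    finally show "(\<Sum>a\<in>Pi\<^sub>E S block_orderings. diagram_value n N d f \<psi> (S, a)) =
      (\<Prod>s\<in>S. joint_cumulant n g c s)" .
  qed
  finally show ?thesis .
qed

theorem theorem1:
  fixes M :: "'a measure" and \<epsilon> :: "nat \<Rightarrow> 'a \<Rightarrow> real"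
    and n N :: nat and d :: "nat \<Rightarrow> nat" and f :: "nat \<Rightarrow> real \<Rightarrow> real"
    and \<psi> :: "nat \<times> nat \<Rightarrow> nat"
  assumes "bernoulli_noise M \<epsilon>"
    and "n \<ge> 1" and "N \<ge> 1"
    and "\<And>i. i \<in> {1..N} \<Longrightarrow> d i \<ge> 1"
    and "\<And>i. i \<in> {1..N} \<Longrightarrow> continuous_on {0..1} (f i)"
    and "bij_betw \<psi> (vertices N d) {1..(\<Sum>i = 1..N. d i)}"
  shows "(LINT \<omega>|M. (\<Prod>i = 1..N. wick_power M (noise_field \<epsilon> n (f i)) (d i) \<omega>)) =
    (\<Sum>G\<in>diagrams N d \<psi>. diagram_value n N d f \<psi> G)"
proof -
  interpret bernoulli_noise M \<epsilon> by fact
  define V where "V = {1..(\<Sum>i = 1..N. d i)}"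
  \<comment> \<open>The numbers stand for the vertices, coloured by the factor to which the vertex
    belongs.\<close>
  define c where "c = fst \<circ> inv_into (vertices N d) \<psi>"
  define g where "g = (\<lambda>i k. f i (real k / real n) * (1 / sqrt (real n)))"
  note \<psi> = assms(6)[folded V_def]
  have fin: "finite V" by (simp add: V_def)
  have inv: "inv_into (vertices N d) \<psi> v \<in> vertices N d" "\<psi> (inv_into (vertices N d) \<psi> v) = v"
    if "v \<in> V" for v
    using that \<psi> by (auto simp: bij_betw_def inv_into_into f_inv_into_f)
  have c_\<psi>: "c (\<psi> (i, j)) = i" if "(i, j) \<in> vertices N d" for i j
    using that \<psi> by (simp add: c_def bij_betw_def)
  have cV: "c ` V \<subseteq> {1..N}"
    using inv(1) by (fastforce simp: c_def vertices_def factor_vertices_def)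
  \<comment> \<open>This translates blocks of one colour into the blocks excluded by
    \<open>diagram_partitions\<close>.\<close>
  have colour: "{v \<in> V. c v = i} = \<psi> ` factor_vertices d i" if i: "i \<in> {1..N}" for i
  proof (intro equalityI subsetI)
    fix v assume "v \<in> {v \<in> V. c v = i}"
    then have v: "v \<in> V" "c v = i" by auto
    have "inv_into (vertices N d) \<psi> v \<in> factor_vertices d i"
      using inv(1)[OF v(1)] v(2) by (auto simp: c_def vertices_def factor_vertices_def)
    then show "v \<in> \<psi> ` factor_vertices d i" using inv(2)[OF v(1)] by (metis imageI)
  next
    fix v assume "v \<in> \<psi> ` factor_vertices d i"
    then obtain j where j: "v = \<psi> (i, j)" "(i, j) \<in> vertices N d"
      using i by (auto simp: vertices_def factor_vertices_def)
    then show "v \<in> {v \<in> V. c v = i}" using \<psi> c_\<psi> by (auto simp: bij_betw_def)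
  qed
  have d: "card {v \<in> V. c v = i} = d i" if i: "i \<in> {1..N}" for i
  proof -
    have "inj_on \<psi> (factor_vertices d i)"
      using i by (intro inj_on_subset[OF bij_betw_imp_inj_on[OF \<psi>]]) (auto simp: vertices_def)
    then show ?thesis
      unfolding colour[OF i] by (simp add: card_image) (simp add: factor_vertices_def card_cartesian_product)
  qed
  have "(LINT \<omega>|M. (\<Prod>i = 1..N. wick_power M (noise_field \<epsilon> n (f i)) (d i) \<omega>)) =
    (LINT \<omega>|M. (\<Prod>i = 1..N. wick_power M (noise_field \<epsilon> n (f i)) (card {v \<in> V. c v = i}) \<omega>))"
    by (simp add: d)
  also have "\<dots> = (\<Sum>S | partition_on V S. \<Prod>s\<in>S. if \<exists>i. c ` s = {i} then 0 else joint_cumulant n g c s)"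
    unfolding g_def using assms(2) fin cV by (intro expectation_prod_wick_power) auto
  also have "\<dots> = (\<Sum>S\<in>diagram_partitions N d \<psi>. \<Prod>s\<in>S. joint_cumulant n g c s)"
  proof (rule sum.mono_neutral_cong_right)
    show "finite {S. partition_on V S}" using fin by (rule finitely_many_partition_on)
    show "diagram_partitions N d \<psi> \<subseteq> {S. partition_on V S}"
      by (auto simp: diagram_partitions_def V_def)
    have mono: "(\<exists>i. c ` s = {i}) \<longleftrightarrow> (\<exists>i\<in>{1..N}. s \<subseteq> \<psi> ` factor_vertices d i)"
      if "partition_on V S" "s \<in> S" for S s
    proof -
      have s: "s \<subseteq> V" "s \<noteq> {}"
        using that partition_onD1[OF that(1)] partition_onD3[OF that(1)] by auto
      \<comment> \<open>A nonempty block takes its single colour from \<open>{1..N}\<close>.\<close>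
      have "(\<exists>i. c ` s = {i}) \<longleftrightarrow> (\<exists>i\<in>{1..N}. c ` s = {i})" using s cV by fastforce
      also have "\<dots> \<longleftrightarrow> (\<exists>i\<in>{1..N}. s \<subseteq> {v \<in> V. c v = i})"
        using s by (intro bex_cong refl) auto
      also have "\<dots> \<longleftrightarrow> (\<exists>i\<in>{1..N}. s \<subseteq> \<psi> ` factor_vertices d i)"
        using colour by auto
      finally show ?thesis .
    qed
    \<comment> \<open>Such a partition has an odd block, whose joint cumulant vanishes because tanh
      is odd, or a block within one factor, whose weight was set to 0.\<close>
    show "\<forall>S\<in>{S. partition_on V S} - diagram_partitions N d \<psi>.
        (\<Prod>s\<in>S. if \<exists>i. c ` s = {i} then 0 else joint_cumulant n g c s) = 0"
    proof
      fix S assume "S \<in> {S. partition_on V S} - diagram_partitions N d \<psi>"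
      then have S: "partition_on V S" and "S \<notin> diagram_partitions N d \<psi>" by auto
      then obtain s where s: "s \<in> S" "odd (card s) \<or> (\<exists>i. c ` s = {i})"
        using mono[OF S] by (auto simp: diagram_partitions_def V_def)
      have "joint_cumulant n g c s = 0" if "odd (card s)"
        using that by (simp add: joint_cumulant_def tanh_coeff_even)
      with s(2) have "(if \<exists>i. c ` s = {i} then 0 else joint_cumulant n g c s) = 0" by auto
      then show "(\<Prod>s\<in>S. if \<exists>i. c ` s = {i} then 0 else joint_cumulant n g c s) = 0"
        using s(1) finite_elements[OF fin S] by (intro prod_zero bexI[of _ s])
    qed
    show "(\<Prod>s\<in>S. if \<exists>i. c ` s = {i} then 0 else joint_cumulant n g c s) =
        (\<Prod>s\<in>S. joint_cumulant n g c s)" if "S \<in> diagram_partitions N d \<psi>" for S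
    proof (intro prod.cong refl)
      fix s assume "s \<in> S"
      moreover have "partition_on V S" using that by (simp add: diagram_partitions_def V_def)
      ultimately have "\<not> (\<exists>i. c ` s = {i})"
        using mono that by (auto simp: diagram_partitions_def)
      then show "(if \<exists>i. c ` s = {i} then 0 else joint_cumulant n g c s) = joint_cumulant n g c s"
        by simp
    qed
  qed
  also have "\<dots> = (\<Sum>G\<in>diagrams N d \<psi>. diagram_value n N d f \<psi> G)"
    unfolding c_def g_def by (rule sum_diagram_value[OF assms(6), symmetric])
  finally show ?thesis .
qed

end
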